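(* Let $A\in\mathbb{R}_{\max}^{n\times n}$ be irreducible, let $B$ be subordinate to $A$, and let $v$ be a vector with only finite entries, i.e. $v\in\mathbb{R}^n$. If $\lambda(B)=-\infty$, then $T_2(A,B,v)\le T_2(A,B)\le \mathrm{cd}_B+1\le n_B$, where $\mathrm{cd}_B=\mathrm{cd}(\mathcal D(B))$. Otherwise, $$T_2(A,B,v)\le\frac{\|v\|+(n-1)\|A\|}{\lambda(A)-\lambda(B)} .$$ If (in this second case) $A$ has only finite entries, then $$T_2(A,B,v)\le\frac{\|v\|+(\lambda(A)-\min_{ij}a_{ij})+(\lambda(B)-\min_{ij}b_{ij})}{\lambda(A)-\lambda(B)}\le\frac{2\|A\|+\|v\|}{\lambda(A)-\lambda(B)}$$ (minima over finite entries).
   Context: Max-plus conventions: $\mathbb{R}_{\max}=\mathbb{R}\cup\{-\infty\}$ with $a\oplus b=\max(a,b)$, $a\otimes b=a+b$; matrix sums, products and powers are max-plus ($A^0=I$ has $0$ on the diagonal and $-\infty$ elsewhere). $\mathcal D(A)$ is the digraph with nodes $1,\dots,n$ and an edge $(i,j)$ of weight $a_{ij}$ whenever $a_{ij}\ne-\infty$; $A$ is irreducible if $\mathcal D(A)$ is strongly connected. A walk $W$ has length $l(W)$ (number of edges) and weight $p(W)$ (sum of edge weights). A path has no repeated node; a cycle is a closed walk of positive length with no repeated node except start $=$ end. $\lambda(A)$ is the maximum of $p(Z)/l(Z)$ over cycles $Z$ ($-\infty$ if there is none). The critical graph $\mathcal G^c(A)$ consists of the nodes and edges lying on cycles of mean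 $\lambda(A)$. The cyclicity of a strongly connected digraph is the gcd of the lengths of its closed walks; of a general digraph it is the lcm of the cyclicities of its strongly connected components. CSR terms (with respect to $\mathcal G=\mathcal G^c(A)$): let $\gamma$ be the cyclicity of $\mathcal G$, $\bar A$ the matrix with entries $a_{ij}-\lambda(A)$, $M=(\bar A^{\gamma})^*$ with $X^*=\bigoplus_{k\ge0}X^k$. Then $c_{ij}=m_{ij}$ if $j$ is a node of $\mathcal G$, else $-\infty$; $r_{ij}=m_{ij}$ if $i$ is a node of $\mathcal G$, else $-\infty$; $s_{ij}=\bar a_{ij}$ if $(i,j)$ is an edge of $\mathcal G$, else $-\infty$. $B$ is subordinate to $A$ if $B$ is obtained from $A$ by setting several entries (typically, all entries in several rows and columns) to $-\infty$. The bounds with denominator $\lambda(A)-\lambda(B)$ are read for $\lambda(B)<\lambda(A)$, which holds in the setting of weak CSR expansions $A^t=(t\lambda(A)\otimes CS^tR)\oplus B^t$, where $\mathcal D(B)$ is a subgraph of $\mathcal D(A)$ disjoint from $\mathcal G^c(A)$. $T_2(A,B)$ is the least integer $T\ge0$ such that $t\lambda(A)\otimes CS^tR\ge B^t$ entrywise for all integers $t\ge T$; $T_2(A,B,v)$ is the least integer $T\ge0$ such that $t\lambda(A)\otimes CS^tRv\ge B^tv$ entrywise for all integers $t\ge T$. $\mathrm{cd}$ = greatest length of a path. $\|A\|$ (resp. $\|v\|$) is the difference between the largest and smallest finite entry of $A$ (resp. $v$). $n_B$ is the size of the smallest submatrix of $B$ containing all its finite entries.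
   Formalization: Real bounds on T_2(A,B,v) are read as: the inequality holds for all integers t ≥ bound (T_2 ≤ its ceiling). For A with only finite entries, B must arise by deleting rows and columns of the same nodes. n_B is the size of the smallest nonempty principal submatrix. *)

theory Defs
  imports "HOL-Analysis.Analysis" "Graph_Theory.Graph_Theory"
begin

text \<open>
  The max-plus semiring is the set of extended reals other than \<open>\<infinity>\<close>, with \<open>max\<close> as addition,
  \<open>+\<close> as multiplication, zero \<open>-\<infinity>\<close> and unit \<open>0\<close>. The operations below are defined on all of
  \<^typ>\<open>ereal\<close>; statements about max-plus matrices assume that no entry is \<open>\<infinity>\<close>, so that an entry
  is finite iff it is not \<open>-\<infinity>\<close>.
\<close>

definition mp_matrix :: "ereal^'n^'n \<Rightarrow> bool" where
  "mp_matrix A \<longleftrightarrow> (\<forall>i j. A $ i $ j \<noteq> \<infinity>)"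

definition mp_one :: "ereal^'n^'n" where
  "mp_one = (\<chi> i j. if i = j then 0 else -\<infinity>)"

definition mp_mult :: "ereal^'n^'n \<Rightarrow> ereal^'n^'n \<Rightarrow> ereal^'n^'n" where
  "mp_mult A B = (\<chi> i j. SUP k. A $ i $ k + B $ k $ j)"

definition mp_mult_vec :: "ereal^'n^'n \<Rightarrow> ereal^'n \<Rightarrow> ereal^'n" where
  "mp_mult_vec A v = (\<chi> i. SUP j. A $ i $ j + v $ j)"

primrec mp_power :: "ereal^'n^'n \<Rightarrow> nat \<Rightarrow> ereal^'n^'n" where
  "mp_power A 0 = mp_one"
| "mp_power A (Suc k) = mp_mult A (mp_power A k)"

definition mp_star :: "ereal^'n^'n \<Rightarrow> ereal^'n^'n" where
  "mp_star A = (\<chi> i j. SUP k. mp_power A k $ i $ j)"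

definition mp_scale :: "ereal \<Rightarrow> ereal^'n^'n \<Rightarrow> ereal^'n^'n" where
  "mp_scale c A = (\<chi> i j. c + A $ i $ j)"


definition assoc_digraph :: "ereal^'n^'n \<Rightarrow> ('n, 'n \<times> 'n) pre_digraph" where
  "assoc_digraph A =
    \<lparr>verts = UNIV, arcs = {(i, j). A $ i $ j \<noteq> -\<infinity>}, tail = fst, head = snd\<rparr>"

text \<open>A digraph with a single node and no edge counts as strongly connected.\<close>

definition mp_irreducible :: "ereal^'n^'n \<Rightarrow> bool" where
  "mp_irreducible A \<longleftrightarrow> strongly_connected (assoc_digraph A)"

definition walk_weight :: "ereal^'n^'n \<Rightarrow> ('n \<times> 'n) awalk \<Rightarrow> ereal" where
  "walk_weight A p = (\<Sum>(i, j)\<leftarrow>p. A $ i $ j)"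

definition walk_mean :: "ereal^'n^'n \<Rightarrow> ('n \<times> 'n) awalk \<Rightarrow> ereal" where
  "walk_mean A p = walk_weight A p / ereal (real (length p))"

definition mp_cycles :: "ereal^'n^'n \<Rightarrow> ('n \<times> 'n) awalk set" where
  "mp_cycles A = {p. pre_digraph.cycle (assoc_digraph A) p}"

definition max_cycle_mean :: "ereal^'n^'n \<Rightarrow> ereal" where
  "max_cycle_mean A =
    (if mp_cycles A = {} then -\<infinity> else Max (walk_mean A ` mp_cycles A))"

definition critical_cycles :: "ereal^'n^'n \<Rightarrow> ('n \<times> 'n) awalk set" where
  "critical_cycles A = {p \<in> mp_cycles A. walk_mean A p = max_cycle_mean A}"

definition critical_graph :: "ereal^'n^'n \<Rightarrow> ('n, 'n \<times> 'n) pre_digraph" where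
  "critical_graph A =
    \<lparr>verts = (\<Union>p\<in>critical_cycles A. fst ` set p),
     arcs = (\<Union>p\<in>critical_cycles A. set p), tail = fst, head = snd\<rparr>"

text \<open>
  The empty closed walk has length \<open>0\<close> and does not affect the gcd. A strongly connected component
  without edges would contribute \<open>0\<close> to the lcm, but critical graphs have no such component; the
  empty digraph has cyclicity \<open>1\<close>.
\<close>

definition scc_cyclicity :: "('a, 'b) pre_digraph \<Rightarrow> nat" where
  "scc_cyclicity H = Gcd {length p | u p. pre_digraph.awalk H u p u}"

definition cyclicity :: "('a, 'b) pre_digraph \<Rightarrow> nat" where
  "cyclicity G = Lcm (scc_cyclicity ` pre_digraph.sccs G)"

definition max_path_length :: "('a, 'b) pre_digraph \<Rightarrow> nat" where
  "max_path_length G = Max {length p | u p w. pre_digraph.apath G u p w}"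


definition mp_normalized :: "ereal^'n^'n \<Rightarrow> ereal^'n^'n" where
  "mp_normalized A = (\<chi> i j. A $ i $ j - max_cycle_mean A)"

definition csr_M :: "ereal^'n^'n \<Rightarrow> ereal^'n^'n" where
  "csr_M A = mp_star (mp_power (mp_normalized A) (cyclicity (critical_graph A)))"

definition csr_C :: "ereal^'n^'n \<Rightarrow> ereal^'n^'n" where
  "csr_C A = (\<chi> i j. if j \<in> verts (critical_graph A) then csr_M A $ i $ j else -\<infinity>)"

definition csr_R :: "ereal^'n^'n \<Rightarrow> ereal^'n^'n" where
  "csr_R A = (\<chi> i j. if i \<in> verts (critical_graph A) then csr_M A $ i $ j else -\<infinity>)"

definition csr_S :: "ereal^'n^'n \<Rightarrow> ereal^'n^'n" where
  "csr_S A = (\<chi> i j. if (i, j) \<in> arcs (critical_graph A) then mp_normalized A $ i $ j else -\<infinity>)"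

definition csr_term :: "ereal^'n^'n \<Rightarrow> nat \<Rightarrow> ereal^'n^'n" where
  "csr_term A t =
    mp_scale (ereal (real t) * max_cycle_mean A)
      (mp_mult (mp_mult (csr_C A) (mp_power (csr_S A) t)) (csr_R A))"


definition subordinate :: "ereal^'n^'n \<Rightarrow> ereal^'n^'n \<Rightarrow> bool" where
  "subordinate B A \<longleftrightarrow> (\<forall>i j. B $ i $ j = A $ i $ j \<or> B $ i $ j = -\<infinity>)"

text \<open>
  The special case in which the deleted entries are those in all rows and all columns whose index
  lies outside some set of nodes, so that the digraph of \<open>B\<close> is an induced subgraph of that of \<open>A\<close>
  (up to isolated nodes). If \<open>A\<close> has only finite entries, this ensures that every nonempty walk in
  the digraph of \<open>B\<close> can be closed by one further edge of \<open>B\<close>, which fails for arbitrary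
  subordinate matrices.
\<close>

definition node_subordinate :: "ereal^'n^'n \<Rightarrow> ereal^'n^'n \<Rightarrow> bool" where
  "node_subordinate B A \<longleftrightarrow>
    (\<exists>N. \<forall>i j. B $ i $ j = (if i \<in> N \<and> j \<in> N then A $ i $ j else -\<infinity>))"

text \<open>
  The values are in \<^typ>\<open>enat\<close>: they are \<open>\<infinity>\<close> if no threshold exists, so that a finite upper bound
  includes the existence of a threshold.
\<close>

definition T2 :: "ereal^'n^'n \<Rightarrow> ereal^'n^'n \<Rightarrow> enat" where
  "T2 A B = (INF T \<in> {T. \<forall>t\<ge>T. \<forall>i j. mp_power B t $ i $ j \<le> csr_term A t $ i $ j}. enat T)"

definition T2_vec :: "ereal^'n^'n \<Rightarrow> ereal^'n^'n \<Rightarrow> ereal^'n \<Rightarrow> enat" where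
  "T2_vec A B v =
    (INF T \<in> {T. \<forall>t\<ge>T. \<forall>i. mp_mult_vec (mp_power B t) v $ i
                          \<le> mp_mult_vec (csr_term A t) v $ i}. enat T)"

text \<open>
  A real upper bound \<open>x\<close> for such a threshold means that the inequality between the matrices or
  vectors holds for all integers \<open>t \<ge> x\<close>. As the threshold itself is the least \<^emph>\<open>integer\<close>, this
  says that it is at most the ceiling of \<open>x\<close>.
\<close>

definition ceil_enat :: "ereal \<Rightarrow> enat" where
  "ceil_enat x = (INF m \<in> {m::nat. x \<le> ereal (real m)}. enat m)"

definition finite_entries :: "ereal^'n^'n \<Rightarrow> ereal set" where
  "finite_entries A = {A $ i $ j | i j. \<bar>A $ i $ j\<bar> \<noteq> \<infinity>}"

definition min_entry :: "ereal^'n^'n \<Rightarrow> ereal" where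
  "min_entry A = Min (finite_entries A)"

definition mp_norm :: "ereal^'n^'n \<Rightarrow> ereal" where
  "mp_norm A = Max (finite_entries A) - Min (finite_entries A)"

definition finite_entries_vec :: "ereal^'n \<Rightarrow> ereal set" where
  "finite_entries_vec v = {v $ i | i. \<bar>v $ i\<bar> \<noteq> \<infinity>}"

definition mp_norm_vec :: "ereal^'n \<Rightarrow> ereal" where
  "mp_norm_vec v = Max (finite_entries_vec v) - Min (finite_entries_vec v)"

text \<open>
  The size of the smallest submatrix containing all finite entries. A submatrix is principal (rows
  and columns indexed by the same nodes) and nonempty, so the size is \<open>1\<close> if all entries are \<open>-\<infinity>\<close>.
\<close>

definition support_size :: "ereal^'n^'n \<Rightarrow> nat" where
  "support_size B =
    Min (card ` {I. I \<noteq> {} \<and> (\<forall>i j. B $ i $ j \<noteq> -\<infinity> \<longrightarrow> i \<in> I \<and> j \<in> I)})"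

end

theory Submission
  imports Defs
begin

text \<open>
  Entries of \<open>B\<^sup>t\<close> are weights of walks of \<open>D(B)\<close> of length \<open>t\<close>. If \<open>\<lambda>(B) = -\<infinity>\<close>, such a walk is a
  path, so there is none for \<open>t > cd\<^sub>B\<close>. Otherwise, removing cycles leaves a path \<open>P\<close>, and the
  weight is at most \<open>p(P) + (t - l(P)) \<lambda>(B)\<close>. Conversely, a walk of \<open>D(A)\<close> that reaches a critical cycle
  \<open>Z\<close> and then stays on it bounds the CSR term from below, since up to a multiple of the cyclicity
  its length may be taken to be \<open>t\<close>.

  Bounding the two paths separately would give more than \<open>(n - 1) \<parallel>A\<parallel>\<close>. Instead, the walk of \<open>D(A)\<close>
  follows \<open>P\<close> up to the last node from which \<open>Z\<close> can be reached without meeting \<open>P\<close> again, so that the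
  nodes of \<open>P\<close>, of the connection and of \<open>Z\<close> are counted only once. If \<open>A\<close> has only finite entries, one
  edge leads to any node of \<open>Z\<close>, and one of the possible starting points on \<open>Z\<close> makes the
  incomplete last round nonnegative because these rounds average to zero.
\<close>

section \<open>Walks in digraphs\<close>

text \<open>Induction on the length: if the vertices after the first are not distinct, a closed
  subwalk \<open>r\<close> can be cut out of \<open>p'\<close>. The edge \<open>e\<close> stays
  outside \<open>r\<close>, so \<open>r\<close> and the remainder are both shorter closed walks, and
  their bounds add up.\<close>

lemma (in wf_digraph) closed_walk_cost_le:
  assumes cyc: "\<And>p. cycle p \<Longrightarrow> (\<Sum>e\<leftarrow>p. f e) \<le> b * real (length p)" and "awalk u p u"
  shows "(\<Sum>e\<leftarrow>p. f e) \<le> b * real (length p)"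
  using assms(2)
proof (induction p arbitrary: u rule: length_induct)
  case (1 p)
  show ?case
  proof (cases p)
    case Nil then show ?thesis by simp
  next
    case (Cons e p')
    with 1 have e: "e \<in> arcs G" "tail G e = u" and p': "awalk (head G e) p' u"
      by (auto simp: awalk_Cons_iff)
    show ?thesis
    proof (cases "distinct (awalk_verts (head G e) p')")
      case True
      then have "cycle p" unfolding cycle_def using 1(2) Cons by auto
      then show ?thesis by (rule cyc)
    next
      case False
      obtain q r s where d: "p' = q @ r @ s"
        "\<exists>w. awalk (head G e) q w \<and> awalk w r w \<and> awalk w s u" "closed_w r"
        using awalk_cyc_decompE'[OF p' False] by metis
      then obtain w where w: "awalk (head G e) q w" "awalk w r w" "awalk w s u" by blast
      have "awalk u (e # q @ s) u" using w e by (auto simp: awalk_Cons_iff)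
      moreover have "0 < length r" using d by (auto simp: closed_w_def)
      ultimately have "(\<Sum>e\<leftarrow>e # q @ s. f e) \<le> b * real (length (e # q @ s))"
        using 1(1)[rule_format, of "e # q @ s" u] Cons d(1) by simp
      moreover have "(\<Sum>e\<leftarrow>r. f e) \<le> b * real (length r)"
        using 1(1)[rule_format, of r w] Cons d(1) w(2) by simp
      ultimately show ?thesis using Cons d by (simp add: algebra_simps)
    qed
  qed
qed

text \<open>Each closed subwalk that is cut out accounts for at most \<open>b\<close> per edge; what
  is left when no vertex repeats is a path.\<close>

lemma (in wf_digraph) walk_cost_le_apath:
  assumes cyc: "\<And>p. cycle p \<Longrightarrow> (\<Sum>e\<leftarrow>p. f e) \<le> b * real (length p)" and "awalk u p v"
  shows "\<exists>q. apath u q v \<and> length q \<le> length p \<and>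
    (\<Sum>e\<leftarrow>p. f e) \<le> (\<Sum>e\<leftarrow>q. f e) + b * (real (length p) - real (length q))"
  using assms(2)
proof (induction p rule: length_induct)
  case (1 p)
  show ?case
  proof (cases "distinct (awalk_verts u p)")
    case True
    then show ?thesis using 1 by (intro exI[of _ p]) (auto simp: apath_def)
  next
    case False
    obtain q r s where d: "p = q @ r @ s"
      "\<exists>w. awalk u q w \<and> awalk w r w \<and> awalk w s v" "closed_w r"
      using awalk_cyc_decompE'[OF 1(2) False] by metis
    then obtain w where w: "awalk u q w" "awalk w r w" "awalk w s v" by blast
    have "awalk u (q @ s) v" using w by auto
    moreover have "0 < length r" using d by (auto simp: closed_w_def)
    ultimately obtain q' where "apath u q' v" "length q' \<le> length (q @ s)"
      "(\<Sum>e\<leftarrow>q @ s. f e) \<le> (\<Sum>e\<leftarrow>q'. f e) + b * (real (length (q @ s)) - real (length q'))"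
      using 1(1)[rule_format, of "q @ s"] d(1) by auto
    moreover have "(\<Sum>e\<leftarrow>r. f e) \<le> b * real (length r)"
      using closed_walk_cost_le[OF cyc w(2)] .
    ultimately show ?thesis using d by (intro exI[of _ q']) (auto simp: algebra_simps)
  qed
qed

text \<open>The vertices after the first are distinct, which bounds the length. Finiteness makes the
  maximum cycle mean an attained maximum.\<close>

lemma (in fin_digraph) finite_cycles: "finite {p. cycle p}"
proof (rule finite_subset)
  show "{p. cycle p} \<subseteq> {p. set p \<subseteq> arcs G \<and> length p \<le> card (verts G)}"
  proof safe
    fix p assume "cycle p"
    then obtain u where u: "awalk u p u" "distinct (tl (awalk_verts u p))" by (auto simp: cycle_def)
    have "set (tl (awalk_verts u p)) \<subseteq> verts G"
      using u(1) list.set_sel(2)[of "awalk_verts u p"] by auto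
    then have "length (tl (awalk_verts u p)) \<le> card (verts G)"
      using distinct_card[OF u(2)] card_mono[OF finite_verts] by metis
    then show "length p \<le> card (verts G)" by (simp add: length_awalk_verts)
  qed (auto simp: cycle_def)
  show "finite {p. set p \<subseteq> arcs G \<and> length p \<le> card (verts G)}"
    by (rule finite_lists_length_le) simp
qed

text \<open>Growing the target set backwards makes the vertices met on the way count only once.\<close>

lemma (in fin_digraph) short_connecting_walk:
  assumes "\<And>u v. u \<in> verts G \<Longrightarrow> v \<in> verts G \<Longrightarrow> u \<rightarrow>\<^sup>* v"
    and "X \<subseteq> verts G" "X \<noteq> {}" "Y \<subseteq> verts G" "Y \<noteq> {}" "X \<inter> Y = {}"
  shows "\<exists>x p y. x \<in> X \<and> y \<in> Y \<and> awalk x p y \<and> card X + length p + card Y \<le> card (verts G) + 1"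
  using assms(4-)
proof (induction "card (verts G) - card Y" arbitrary: Y rule: less_induct)
  case less
  obtain u y where uy: "u \<in> X" "y \<in> Y" using assms(3) less(3) by blast
  then have "u \<notin> Y" using less(4) by blast
  have "u \<rightarrow>\<^sup>* y" using uy assms(2) less(2) by (intro assms(1)) auto
  then obtain p where "awalk u p y" unfolding reachable_awalk ..
  \<comment> \<open>A walk from outside \<open>Y\<close> into \<open>Y\<close> must contain an edge
    that enters \<open>Y\<close>.\<close>
  then have "\<exists>e\<in>arcs G. tail G e \<notin> Y \<and> head G e \<in> Y" using \<open>u \<notin> Y\<close>
  proof (induction p arbitrary: u)
    case Nil
    then show ?case using uy(2) by (simp add: awalk_Nil_iff)
  next
    case (Cons e p)
    then show ?case by (cases "head G e \<in> Y") (auto simp: awalk_Cons_iff)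
  qed
  then obtain e where e: "e \<in> arcs G" "tail G e \<notin> Y" "head G e \<in> Y" by blast
  have fin: "finite X" "finite Y" using assms(2) less(2) by (auto intro: finite_subset[OF _ finite_verts])
  show ?case
  proof (cases "tail G e \<in> X")
    case True
    have "card X + card Y \<le> card (verts G)"
      using card_mono[of "verts G" "X \<union> Y"] card_Un_disjoint[of X Y] fin assms(2) less by auto
    then show ?thesis using True e arc_implies_awalk[of e]
      by (intro exI[of _ "tail G e"] exI[of _ "[e]"] exI[of _ "head G e"]) auto
  next
    case False
    have "insert (tail G e) Y \<subseteq> verts G" using less e by auto
    then have "Suc (card Y) \<le> card (verts G)"
      using card_mono[of "verts G" "insert (tail G e) Y"] e fin by simp
    \<comment> \<open>Adding \<open>tail G e\<close> to the target raises its cardinality by one.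
      This pays for the edge \<open>e\<close>, which is appended if the walk ends at the added
      vertex.\<close>
    then have "\<exists>x p y. x \<in> X \<and> y \<in> insert (tail G e) Y \<and> awalk x p y \<and>
        card X + length p + card (insert (tail G e) Y) \<le> card (verts G) + 1"
      by (intro less(1)) (use False less e fin in auto)
    then obtain x p y' where p: "x \<in> X" "y' \<in> insert (tail G e) Y" "awalk x p y'"
        "card X + length p + card Y + 1 \<le> card (verts G) + 1" using e fin by auto
    show ?thesis
    proof (cases "y' \<in> Y")
      case True then show ?thesis using p by (intro exI[of _ x] exI[of _ p] exI[of _ y']) auto
    next
      case False
      then have "y' = tail G e" using p by auto
      then have "awalk x (p @ [e]) (head G e)" using p e arc_implies_awalk[of e] by auto
      then show ?thesis using p e
        by (intro exI[of _ x] exI[of _ "p @ [e]"] exI[of _ "head G e"]) auto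
    qed
  qed
qed

text \<open>
  If the path meets \<open>C\<close>, it is left at its last vertex in \<open>C\<close>; otherwise it is left at the start of a
  shortest connection to \<open>C\<close>.
\<close>

lemma (in fin_digraph) apath_divert:
  assumes conn: "\<And>u v. u \<in> verts G \<Longrightarrow> v \<in> verts G \<Longrightarrow> u \<rightarrow>\<^sup>* v"
    and p: "apath u p v" and C: "C \<subseteq> verts G" "C \<noteq> {}"
  shows "\<exists>p1 p2 w z k. p = p1 @ p2 \<and> awalk u p1 w \<and> awalk w z k \<and> k \<in> C \<and>
    (z = [] \<and> length p2 + card C \<le> card (verts G) \<or> length p + length z + card C \<le> card (verts G))"
proof -
  have aw: "awalk u p v" and dist: "distinct (awalk_verts u p)" using p by (auto simp: apath_def)
  have sub: "set (awalk_verts u p) \<subseteq> verts G" using aw by auto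
  show ?thesis
  proof (cases "set (awalk_verts u p) \<inter> C = {}")
    case True
    obtain x z y where z: "x \<in> set (awalk_verts u p)" "y \<in> C" "awalk x z y"
      "card (set (awalk_verts u p)) + length z + card C \<le> card (verts G) + 1"
      using short_connecting_walk[OF conn sub _ C True] by auto
    \<comment> \<open>The path has one vertex more than it has edges, which absorbs the
      \<open>+ 1\<close> in the bound for the connecting walk.\<close>
    have "card (set (awalk_verts u p)) = length p + 1"
      using dist by (simp add: distinct_card length_awalk_verts)
    moreover obtain p1 p2 where "p = p1 @ p2" "awalk u p1 x"
      using awalk_decomp[OF aw z(1)] by blast
    ultimately have "p = p1 @ p2 \<and> awalk u p1 x \<and> awalk x z y \<and> y \<in> C \<and>
        length p + length z + card C \<le> card (verts G)"
      using z by simp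
    then show ?thesis by blast
  next
    case False
    then obtain xs w ys where v: "awalk_verts u p = xs @ w # ys" "w \<in> C" "\<forall>y\<in>set ys. y \<notin> C"
      using split_list_last_prop[of "awalk_verts u p" "\<lambda>x. x \<in> C"] by blast
    from aw have "cas u p v" by auto
    then obtain p1 p2 where p12: "cas u p1 w" "cas w p2 v" "p = p1 @ p2"
      "awalk_verts w p2 = w # ys" using v(1) by (rule awalk_decomp_verts)
    then have aw1: "awalk u p1 w" using aw by (auto simp: awalk_def)
    have "length p2 = length ys" using p12(4) length_awalk_verts[of w p2] by simp
    moreover have "length ys + card C \<le> card (verts G)"
    proof -
      \<comment> \<open>The vertices after the last one in \<open>C\<close> are distinct and avoid
        \<open>C\<close>, so they can be counted together with \<open>C\<close>.\<close>
      have "card (set ys \<union> C) = length ys + card C"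
        using dist v C by (subst card_Un_disjoint) (auto simp: distinct_card intro: finite_subset)
      moreover have "card (set ys \<union> C) \<le> card (verts G)"
        using sub v C by (intro card_mono) auto
      ultimately show ?thesis by simp
    qed
    moreover have "awalk w [] w" using aw1 by (auto simp: awalk_Nil_iff)
    ultimately have "p = p1 @ p2 \<and> awalk u p1 w \<and> awalk w [] w \<and> w \<in> C \<and>
        [] = [] \<and> length p2 + card C \<le> card (verts G)"
      using p12(3) aw1 v(2) by simp
    then show ?thesis by metis
  qed
qed

section \<open>Cycle means and the critical graph\<close>

lemma assoc_digraph_sel [simp]:
  "verts (assoc_digraph A) = UNIV"
  "arcs (assoc_digraph A) = {(i, j). A $ i $ j \<noteq> -\<infinity>}"
  "tail (assoc_digraph A) = fst" "head (assoc_digraph A) = snd"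
  by (simp_all add: assoc_digraph_def)

interpretation assoc: fin_digraph "assoc_digraph A" for A :: "ereal^'n^'n"
  by unfold_locales auto

text \<open>Real weights allow subtraction and averaging. At an infinite entry the value is the
  default \<open>0\<close>, so it is meaningful as a weight only on edges.\<close>

definition arc_cost :: "ereal^'n^'n \<Rightarrow> 'n \<times> 'n \<Rightarrow> real" where
  "arc_cost A = (\<lambda>(i, j). real_of_ereal (A $ i $ j))"

lemma ereal_arc_cost:
  assumes "mp_matrix A" and "A $ i $ j \<noteq> -\<infinity>"
  shows "A $ i $ j = ereal (arc_cost A (i, j))"
  using assms by (cases "A $ i $ j") (auto simp: mp_matrix_def arc_cost_def)

lemma walk_weight_eq_cost:
  assumes "mp_matrix A" and "set p \<subseteq> arcs (assoc_digraph A)"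
  shows "walk_weight A p = ereal ((\<Sum>e\<leftarrow>p. arc_cost A e))"
  using assms(2)
proof (induction p)
  case (Cons e p)
  then have "A $ fst e $ snd e = ereal (arc_cost A e)"
    using ereal_arc_cost[OF assms(1), of "fst e" "snd e"] by (simp add: case_prod_beta)
  then show ?case using Cons by (simp add: walk_weight_def case_prod_beta)
qed (simp add: walk_weight_def)

lemma finite_mp_cycles: "finite (mp_cycles A)"
  using assoc.finite_cycles by (simp add: mp_cycles_def)

lemma mp_cyclesD:
  assumes "p \<in> mp_cycles A"
  obtains u where "assoc.awalk A u p u" "p \<noteq> []"
    "distinct (tl (assoc.awalk_verts A u p))"
  using assms by (auto simp: mp_cycles_def assoc.cycle_def)

lemma walk_mean_eq:
  assumes "mp_matrix A" and "p \<in> mp_cycles A"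
  shows "walk_mean A p = ereal ((\<Sum>e\<leftarrow>p. arc_cost A e) / real (length p))"
proof -
  obtain u where "assoc.awalk A u p u" "p \<noteq> []" using mp_cyclesD[OF assms(2)] .
  then show ?thesis
    using walk_weight_eq_cost[OF assms(1), of p] by (auto simp: walk_mean_def assoc.awalk_def)
qed

text \<open>The maximum over the finitely many cycles is attained, and cycle weights are real. Means
  are multiplied out by the length, which is the form needed for decomposing closed walks.\<close>

lemma max_cycle_mean_finite:
  assumes "mp_matrix A" and "max_cycle_mean A \<noteq> -\<infinity>"
  obtains a where "max_cycle_mean A = ereal a"
    and "\<And>p. p \<in> mp_cycles A \<Longrightarrow> (\<Sum>e\<leftarrow>p. arc_cost A e) \<le> a * real (length p)"
    and "critical_cycles A \<noteq> {}"
    and "\<And>p. p \<in> critical_cycles A \<Longrightarrow> (\<Sum>e\<leftarrow>p. arc_cost A e) = a * real (length p)"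
proof -
  have ne: "mp_cycles A \<noteq> {}" using assms(2) by (auto simp: max_cycle_mean_def)
  have m: "max_cycle_mean A = Max (walk_mean A ` mp_cycles A)"
    using ne by (simp add: max_cycle_mean_def)
  have "max_cycle_mean A \<in> walk_mean A ` mp_cycles A"
    unfolding m using finite_mp_cycles[of A] ne by (intro Max_in) auto
  then obtain c where c: "c \<in> mp_cycles A" "max_cycle_mean A = walk_mean A c" by auto
  define a where "a = (\<Sum>e\<leftarrow>c. arc_cost A e) / real (length c)"
  have a: "max_cycle_mean A = ereal a"
    using c walk_mean_eq[OF assms(1)] by (simp add: a_def)
  show thesis
  proof
    show "max_cycle_mean A = ereal a" by (rule a)
    show "(\<Sum>e\<leftarrow>p. arc_cost A e) \<le> a * real (length p)" if p: "p \<in> mp_cycles A" for p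
    proof -
      have "walk_mean A p \<le> ereal a"
        using Max_ge[of "walk_mean A ` mp_cycles A"] finite_mp_cycles[of A] p m a by auto
      moreover have "length p > 0" using mp_cyclesD[OF p] by auto
      ultimately show ?thesis using walk_mean_eq[OF assms(1) p] by (simp add: field_simps)
    qed
    show "critical_cycles A \<noteq> {}" using c by (auto simp: critical_cycles_def)
    show "(\<Sum>e\<leftarrow>p. arc_cost A e) = a * real (length p)" if p: "p \<in> critical_cycles A" for p
    proof -
      have "p \<in> mp_cycles A" "walk_mean A p = ereal a"
        using p a by (auto simp: critical_cycles_def)
      moreover have "length p > 0" using mp_cyclesD[OF \<open>p \<in> mp_cycles A\<close>] by auto
      ultimately show ?thesis using walk_mean_eq[OF assms(1), of p] by (simp add: field_simps)
    qed
  qed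
qed

text \<open>The real value \<open>a\<close> is a parameter here, so that several facts about one
  matrix share the same \<open>a\<close>.\<close>

lemma
  assumes "mp_matrix A" and "max_cycle_mean A = ereal a"
  shows cycle_cost_le: "assoc.cycle A p \<Longrightarrow> (\<Sum>e\<leftarrow>p. arc_cost A e) \<le> a * real (length p)"
    and critical_cycles_nonempty: "critical_cycles A \<noteq> {}"
    and critical_cycle_cost:
      "p \<in> critical_cycles A \<Longrightarrow> (\<Sum>e\<leftarrow>p. arc_cost A e) = a * real (length p)"
proof -
  have "max_cycle_mean A \<noteq> -\<infinity>" using assms(2) by simp
  then obtain a' where "max_cycle_mean A = ereal a'"
    and "\<And>p. p \<in> mp_cycles A \<Longrightarrow> (\<Sum>e\<leftarrow>p. arc_cost A e) \<le> a' * real (length p)"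
    and "critical_cycles A \<noteq> {}"
    and "\<And>p. p \<in> critical_cycles A \<Longrightarrow> (\<Sum>e\<leftarrow>p. arc_cost A e) = a' * real (length p)"
    using max_cycle_mean_finite[OF assms(1)] by metis
  then show "assoc.cycle A p \<Longrightarrow> (\<Sum>e\<leftarrow>p. arc_cost A e) \<le> a * real (length p)"
    and "critical_cycles A \<noteq> {}"
    and "p \<in> critical_cycles A \<Longrightarrow> (\<Sum>e\<leftarrow>p. arc_cost A e) = a * real (length p)"
    using assms(2) by (simp_all add: mp_cycles_def)
qed

lemma awalk_heads_subset: "assoc.awalk A u p v \<Longrightarrow> snd ` set p \<subseteq> insert v (fst ` set p)"
proof (induction p arbitrary: u)
  case (Cons e p)
  then have w: "assoc.awalk A (snd e) p v" by (auto simp: assoc.awalk_Cons_iff)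
  then have "snd e \<in> insert v (fst ` set p)"
    by (cases p) (auto simp: assoc.awalk_Cons_iff assoc.awalk_Nil_iff)
  then show ?case using Cons.IH[OF w] by auto
qed simp

text \<open>Every head on a closed walk is the tail of the next edge. This is why the critical
  graph, whose nodes are defined as tails, contains the heads of its edges.\<close>

lemma cycle_heads_subset:
  assumes "p \<in> mp_cycles A"
  shows "snd ` set p \<subseteq> fst ` set p"
proof -
  obtain u where u: "assoc.awalk A u p u" "p \<noteq> []" using mp_cyclesD[OF assms] .
  then have "u \<in> fst ` set p" by (cases p) (auto simp: assoc.awalk_Cons_iff)
  then show ?thesis using awalk_heads_subset[OF u(1)] by blast
qed

text \<open>The heads are distinct because no node after the start repeats, and they lie among the
  tails; there are at most as many tails as edges.\<close>

lemma card_cycle_verts: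
  assumes "p \<in> mp_cycles A"
  shows "card (fst ` set p) = length p"
proof -
  obtain u where u: "assoc.awalk A u p u" "p \<noteq> []" "distinct (tl (assoc.awalk_verts A u p))"
    using mp_cyclesD[OF assms] .
  have "assoc.cas A u p u" using u(1) by (simp add: assoc.awalk_def)
  then have "assoc.awalk_verts A u p = fst (hd p) # map snd p"
    using u(2) by (simp add: assoc.awalk_verts_conv')
  then have eq: "tl (assoc.awalk_verts A u p) = map snd p" by simp
  have "card (snd ` set p) = length p"
    using u(3) eq distinct_card[of "map snd p"] by simp
  moreover have "card (snd ` set p) \<le> card (fst ` set p)"
    by (intro card_mono cycle_heads_subset[OF assms]) simp
  moreover have "card (fst ` set p) \<le> length p"
    using card_length[of "map fst p"] by simp
  ultimately show ?thesis by simp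
qed

lemma critical_graph_sel [simp]:
  "verts (critical_graph A) = (\<Union>p\<in>critical_cycles A. fst ` set p)"
  "arcs (critical_graph A) = (\<Union>p\<in>critical_cycles A. set p)"
  "tail (critical_graph A) = fst" "head (critical_graph A) = snd"
  by (simp_all add: critical_graph_def)

interpretation crit: fin_digraph "critical_graph A" for A :: "ereal^'n^'n"
proof
  fix e assume e: "e \<in> arcs (critical_graph A)"
  then show "tail (critical_graph A) e \<in> verts (critical_graph A)" by auto
  from e obtain p where p: "p \<in> critical_cycles A" "e \<in> set p" by auto
  then have "snd e \<in> fst ` set p"
    using cycle_heads_subset[of p A] by (auto simp: critical_cycles_def)
  then show "head (critical_graph A) e \<in> verts (critical_graph A)"
    using p(1) by auto
next
  show "finite (verts (critical_graph A))" by (rule finite)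
  show "finite (arcs (critical_graph A))" by (rule finite)
qed

text \<open>Incidence along a walk depends only on the two endpoint maps, so walks can be moved
  between digraphs that share them.\<close>

lemma cas_cong:
  "tail G = tail H \<Longrightarrow> head G = head H \<Longrightarrow> pre_digraph.cas G u p v = pre_digraph.cas H u p v"
  by (induction p arbitrary: u) (auto simp: pre_digraph.cas.simps)

text \<open>Every component contains a node \<open>u\<close> of a critical cycle. The edge
  \<open>e\<close> leaving \<open>u\<close> on that cycle stays in the component and extends to a
  nonempty closed walk there. So each gcd is nonzero, and so is the lcm of finitely many of
  them.\<close>

lemma cyclicity_critical_graph_pos: "cyclicity (critical_graph A) > 0"
proof -
  let ?G = "critical_graph A"
  have nz: "scc_cyclicity H \<noteq> 0" if H: "H \<in> crit.sccs A" for H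
  proof -
    have ind: "induced_subgraph H ?G" and sc: "strongly_connected H"
      using H by (auto simp: crit.sccs_def)
    have wf: "wf_digraph H" and th: "tail H = fst" "head H = snd"
      using ind by (auto simp: induced_subgraph_def subgraph_def compatible_def)
    interpret H: wf_digraph H by (rule wf)
    have S: "verts H \<in> crit.sccs_verts A" using H by (intro crit.in_sccs_vertsI_sccs imageI)
    obtain u where u: "u \<in> verts H" using sc by (auto simp: strongly_connected_def)
    then have "u \<in> verts ?G" using ind unfolding induced_subgraph_def subgraph_def by blast
    then obtain p e where p: "p \<in> critical_cycles A" "e \<in> set p" "fst e = u" by auto
    obtain p1 p2 where p12: "p = p1 @ e # p2" using p(2) by (auto simp: in_set_conv_decomp)
    have "p \<in> mp_cycles A" using p by (simp add: critical_cycles_def)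
    then obtain x where "assoc.awalk A x p x" by (rule mp_cyclesD)
    then have "assoc.awalk A x p1 u" "assoc.awalk A (snd e) p2 x"
      using p12 p(3) by (auto simp: assoc.awalk_Cons_iff)
    \<comment> \<open>Rotating the cycle gives the walk \<open>p2 @ p1\<close> from the head of
      \<open>e\<close> back to \<open>u\<close>.\<close>
    then have "assoc.cas A (snd e) (p2 @ p1) u" by (auto simp: assoc.awalk_def)
    then have cas: "crit.cas A (snd e) (p2 @ p1) u"
      by (subst cas_cong[of _ "assoc_digraph A"]) auto
    have "set p \<subseteq> arcs ?G" using p(1) by auto
    then have eG: "e \<in> arcs ?G" "set (p2 @ p1) \<subseteq> arcs ?G" using p12 by simp_all
    have "snd e \<in> verts ?G" using crit.head_in_verts[OF eG(1)] by simp
    then have "crit.awalk A (snd e) (p2 @ p1) u" using cas eG(2) by (simp add: crit.awalk_def)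
    then have 1: "snd e \<rightarrow>\<^sup>*\<^bsub>?G\<^esub> u" by (rule crit.reachable_awalkI)
    have "crit.awalk A u [e] (snd e)" using crit.arc_implies_awalk[OF eG(1)] p(3) by simp
    then have 2: "u \<rightarrow>\<^sup>*\<^bsub>?G\<^esub> snd e" by (rule crit.reachable_awalkI)
    \<comment> \<open>Mutual reachability puts \<open>snd e\<close> into the component of
      \<open>u\<close>; being an induced subgraph, the component then contains
      \<open>e\<close>.\<close>
    have v: "snd e \<in> verts H" using S u 1 2 unfolding crit.sccs_verts_def by blast
    have "e \<in> arcs H"
      using ind eG(1) u v p(3) unfolding induced_subgraph_def by simp
    have "snd e \<rightarrow>\<^sup>*\<^bsub>H\<^esub> u" using sc u v unfolding strongly_connected_def by blast
    then obtain q where "H.awalk (snd e) q u" unfolding H.reachable_awalk ..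
    then have "H.awalk u (e # q) u"
      using \<open>e \<in> arcs H\<close> p(3) by (auto simp: H.awalk_Cons_iff th)
    then have "length (e # q) \<in> {length p | u p. pre_digraph.awalk H u p u}" by blast
    moreover have "length (e # q) \<notin> {0}" by simp
    ultimately show ?thesis unfolding scc_cyclicity_def Gcd_0_iff by (meson subsetD)
  qed
  have "finite (crit.sccs A)"
    unfolding crit.sccs_conv_sccs_verts
    by (intro finite_imageI finite)
  then have "finite (scc_cyclicity ` crit.sccs A)" by (rule finite_imageI)
  moreover have "0 \<notin> scc_cyclicity ` crit.sccs A" using nz by force
  ultimately have "Lcm (scc_cyclicity ` crit.sccs A) \<noteq> 0" using Lcm_0_iff by blast
  then show ?thesis unfolding cyclicity_def by (simp only: neq0_conv)
qed

section \<open>Lower bounds for CSR terms\<close>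

lemma mp_mult_ge: "X $ i $ k + Y $ k $ j \<le> mp_mult X Y $ i $ j"
  by (auto simp: mp_mult_def intro: SUP_upper)

lemma mp_mult_vec_ge: "X $ i $ j + v $ j \<le> mp_mult_vec X v $ i"
  by (auto simp: mp_mult_vec_def intro: SUP_upper)

text \<open>A walk, given as a sequence of nodes, is one of the terms over which the power
  maximises. The offset \<open>s\<close> moves on as the first edge is split off.\<close>

lemma sum_le_mp_power:
  "(\<Sum>k<t. X $ x (s + k) $ x (Suc (s + k))) \<le> mp_power X t $ x s $ x (s + t)"
proof (induction t arbitrary: s)
  case 0
  then show ?case by (simp add: mp_one_def)
next
  case (Suc t)
  have "(\<Sum>k<Suc t. X $ x (s + k) $ x (Suc (s + k))) =
      X $ x s $ x (Suc s) + (\<Sum>k<t. X $ x (Suc s + k) $ x (Suc (Suc s + k)))"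
    by (subst sum.lessThan_Suc_shift) simp
  also have "\<dots> \<le> X $ x s $ x (Suc s) + mp_power X t $ x (Suc s) $ x (Suc s + t)"
    by (intro add_left_mono Suc.IH)
  also have "\<dots> \<le> mp_power X (Suc t) $ x s $ x (s + Suc t)"
    using mp_mult_ge[of X "x s" "x (Suc s)" "mp_power X t" "x (Suc s + t)"] by simp
  finally show ?case .
qed

text \<open>The walk is cut into \<open>m\<close> blocks of \<open>g\<close> edges; each block is
  bounded by an entry of the inner power.\<close>

lemma sum_le_mp_power_mp_power:
  "(\<Sum>k<m * g. X $ x k $ x (Suc k)) \<le> mp_power (mp_power X g) m $ x 0 $ x (m * g)"
proof -
  have "(\<Sum>k<m * g. X $ x k $ x (Suc k)) =
      (\<Sum>l<m. \<Sum>k\<in>{l * g..<l * g + g}. X $ x k $ x (Suc k))"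
    by (rule sum.nat_group[symmetric])
  also have "\<dots> = (\<Sum>l<m. \<Sum>k<g. X $ x (l * g + k) $ x (Suc (l * g + k)))"
    by (simp add: sum.atLeastLessThan_shift_0[of _ "_ * g"] atLeast0LessThan)
  also have "\<dots> \<le> (\<Sum>l<m. mp_power X g $ x (l * g) $ x (l * g + g))"
    by (intro sum_mono sum_le_mp_power)
  also have "\<dots> \<le> mp_power (mp_power X g) m $ x (0 * g) $ x (m * g)"
    using sum_le_mp_power[of "mp_power X g" "\<lambda>l. x (l * g)" 0 m] by (simp add: add.commute)
  finally show ?thesis by simp
qed

text \<open>The index type is finite, so the supremum in the product is attained; following the
  maximising indices yields the walk.\<close>

lemma mp_power_attained:
  assumes "mp_matrix B" and "mp_power B t $ i $ j \<noteq> -\<infinity>"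
  shows "\<exists>p. assoc.awalk B i p j \<and> length p = t \<and>
    mp_power B t $ i $ j = ereal (\<Sum>e\<leftarrow>p. arc_cost B e)"
  using assms(2)
proof (induction t arbitrary: i)
  case 0
  then show ?case by (auto simp: mp_one_def assoc.awalk_Nil_iff split: if_splits)
next
  case (Suc t)
  have "(SUP k. B $ i $ k + mp_power B t $ k $ j) \<in> range (\<lambda>k. B $ i $ k + mp_power B t $ k $ j)"
    using Max_in[of "range (\<lambda>k. B $ i $ k + mp_power B t $ k $ j)"] by (simp add: Max_Sup)
  then obtain k where k: "mp_power B (Suc t) $ i $ j = B $ i $ k + mp_power B t $ k $ j"
    by (auto simp: mp_mult_def)
  \<comment> \<open>On extended reals \<open>-\<infinity> + \<infinity> = \<infinity>\<close>, so
    \<open>\<infinity>\<close> has to be excluded before both summands can be seen to be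
    finite.\<close>
  have "mp_power B t $ k $ j \<noteq> \<infinity>"
    using Suc.IH[of k] by (cases "mp_power B t $ k $ j = -\<infinity>") auto
  then have "B $ i $ k \<noteq> -\<infinity>" "mp_power B t $ k $ j \<noteq> -\<infinity>"
    using Suc.prems assms(1) k by (auto simp: mp_matrix_def)
  moreover from this obtain p where p: "assoc.awalk B k p j" "length p = t"
    "mp_power B t $ k $ j = ereal (\<Sum>e\<leftarrow>p. arc_cost B e)" using Suc.IH by blast
  ultimately show ?case
    using k ereal_arc_cost[OF assms(1), of i k]
    by (intro exI[of _ "(i, k) # p"]) (auto simp: assoc.awalk_Cons_iff)
qed

text \<open>The walk is cut at \<open>N\<close>: the matrix \<open>C\<close> takes the first
  \<open>N\<close> edges, whose number is a multiple of the cyclicity, \<open>S\<^sup>t\<close>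
  takes the next \<open>t\<close>, and \<open>R\<close> takes the empty walk. As the cyclicity is
  positive, \<open>l \<le> N\<close>, so the nodes at \<open>N\<close> and \<open>N + t\<close> are
  critical.\<close>

lemma csr_term_ge:
  assumes A: "mp_matrix A" and a: "max_cycle_mean A = ereal a"
    and arcs: "\<And>k. (x k, x (Suc k)) \<in> arcs (assoc_digraph A)"
    and crit: "\<And>k. l \<le> k \<Longrightarrow> (x k, x (Suc k)) \<in> arcs (critical_graph A)"
    and N: "N = l * cyclicity (critical_graph A)"
  shows "ereal (real t * a + (\<Sum>k<N + t. arc_cost A (x k, x (Suc k)) - a))
    \<le> csr_term A t $ x 0 $ x (N + t)"
proof -
  define g where "g = cyclicity (critical_graph A)"
  define w where "w k = arc_cost A (x k, x (Suc k)) - a" for k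
  have "l \<le> N" using cyclicity_critical_graph_pos[of A] N by simp
  have norm: "mp_normalized A $ x k $ x (Suc k) = ereal (w k)" for k
    using ereal_arc_cost[OF A, of "x k" "x (Suc k)"] arcs[of k] by (simp add: mp_normalized_def a w_def)
  have node: "x k \<in> verts (critical_graph A)" if "l \<le> k" for k
    using crit.tail_in_verts[OF crit[OF that]] by simp
  have M: "mp_power (mp_power (mp_normalized A) g) m $ i $ j \<le> csr_M A $ i $ j" for m i j
    by (auto simp: csr_M_def mp_star_def g_def intro: SUP_upper)
  have "ereal (\<Sum>k<N. w k) = (\<Sum>k<l * g. mp_normalized A $ x k $ x (Suc k))"
    by (simp add: norm N g_def)
  also have "\<dots> \<le> csr_C A $ x 0 $ x N"
    using sum_le_mp_power_mp_power[of "mp_normalized A" x l g] M[of l "x 0" "x N"] node[OF \<open>l \<le> N\<close>]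
    by (auto simp: csr_C_def N g_def)
  finally have C: "ereal (\<Sum>k<N. w k) \<le> csr_C A $ x 0 $ x N" .
  have "ereal (\<Sum>k<t. w (N + k)) = (\<Sum>k<t. csr_S A $ x (N + k) $ x (Suc (N + k)))"
    using crit \<open>l \<le> N\<close> by (simp add: csr_S_def norm del: critical_graph_sel)
  also have "\<dots> \<le> mp_power (csr_S A) t $ x N $ x (N + t)" by (rule sum_le_mp_power)
  finally have S: "ereal (\<Sum>k<t. w (N + k)) \<le> mp_power (csr_S A) t $ x N $ x (N + t)" .
  have R: "0 \<le> csr_R A $ x (N + t) $ x (N + t)"
    using M[of 0 "x (N + t)" "x (N + t)"] node[of "N + t"] \<open>l \<le> N\<close>
    by (simp add: csr_R_def mp_one_def del: critical_graph_sel)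
  have "(\<Sum>k<N + t. w k) = (\<Sum>k<N. w k) + (\<Sum>k<t. w (N + k))"
    by (induction t) auto
  then have "ereal (real t * a + (\<Sum>k<N + t. w k)) =
      ereal (real t) * max_cycle_mean A + (ereal (\<Sum>k<N. w k) + ereal (\<Sum>k<t. w (N + k)) + 0)"
    by (simp add: a)
  also have "\<dots> \<le> ereal (real t) * max_cycle_mean A +
      (csr_C A $ x 0 $ x N + mp_power (csr_S A) t $ x N $ x (N + t) + csr_R A $ x (N + t) $ x (N + t))"
    by (intro add_left_mono add_mono C S R)
  also have "\<dots> \<le> csr_term A t $ x 0 $ x (N + t)"
    unfolding csr_term_def mp_scale_def vec_lambda_beta
    by (intro add_left_mono order_trans[OF add_right_mono mp_mult_ge] mp_mult_ge)
  finally show ?thesis by (simp add: w_def)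
qed

lemma awalk_snd_nth:
  "assoc.awalk A u p v \<Longrightarrow> k < length p \<Longrightarrow>
    snd (p ! k) = (if Suc k < length p then fst (p ! Suc k) else v)"
proof (induction p arbitrary: u k)
  case (Cons e p)
  then have w: "assoc.awalk A (snd e) p v" by (auto simp: assoc.awalk_Cons_iff)
  show ?case
  proof (cases k)
    case 0
    then show ?thesis using w by (cases p) (auto simp: assoc.awalk_Cons_iff assoc.awalk_Nil_iff)
  next
    case (Suc k')
    then show ?thesis using Cons.IH[OF w, of k'] Cons.prems by simp
  qed
qed simp

lemma cycle_snd_nth:
  assumes "c \<in> mp_cycles A"
  shows "snd (c ! (m mod length c)) = fst (c ! (Suc m mod length c))"
proof -
  obtain u where u: "assoc.awalk A u c u" "c \<noteq> []" using mp_cyclesD[OF assms] .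
  then have "fst (c ! 0) = u" by (cases c) (auto simp: assoc.awalk_Cons_iff)
  moreover have "m mod length c < length c" using u(2) by simp
  ultimately show ?thesis
    using awalk_snd_nth[OF u(1), of "m mod length c"]
    by (cases "Suc (m mod length c) = length c") (simp_all add: mod_Suc)
qed

text \<open>The walk follows \<open>r\<close> and then goes round \<open>c\<close> from index
  \<open>s\<close>. In total \<open>C\<close> and \<open>S\<^sup>t\<close> use
  \<open>length r\<close> times the cyclicity plus \<open>t\<close> edges, of which \<open>q\<close>
  lie on the cycle. The final node is left open, since with a finite vector every column is
  available.\<close>

lemma csr_term_ge_walk:
  assumes A: "mp_matrix A" and a: "max_cycle_mean A = ereal a"
    and c: "c \<in> critical_cycles A"
    and r: "assoc.awalk A i r (fst (c ! (s mod length c)))"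
    and q: "q = length r * cyclicity (critical_graph A) + t - length r"
  shows "\<exists>j. ereal (real t * a + ((\<Sum>e\<leftarrow>r. arc_cost A e) - real (length r) * a)
      + (\<Sum>k<q. arc_cost A (c ! ((s + k) mod length c)) - a)) \<le> csr_term A t $ i $ j"
proof -
  define x where
    "x k = (if k < length r then fst (r ! k) else fst (c ! ((s + (k - length r)) mod length c)))" for k
  let ?N = "length r * cyclicity (critical_graph A)"
  have cyc: "c \<in> mp_cycles A" using c by (simp add: critical_cycles_def)
  obtain u where u: "assoc.awalk A u c u" "c \<noteq> []" using mp_cyclesD[OF cyc] .
  have early: "(x k, x (Suc k)) = r ! k" if "k < length r" for k
    using awalk_snd_nth[OF r that] that
    by (cases "Suc k = length r") (auto simp: x_def prod_eq_iff)
  have late: "(x k, x (Suc k)) = c ! ((s + (k - length r)) mod length c)" if "length r \<le> k" for k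
    using cycle_snd_nth[OF cyc, of "s + (k - length r)"] that
    by (auto simp: x_def prod_eq_iff Suc_diff_le)
  have cset: "c ! (m mod length c) \<in> set c" for m using u(2) by simp
  have arcs: "(x k, x (Suc k)) \<in> arcs (assoc_digraph A)" for k
  proof (cases "k < length r")
    case True
    then show ?thesis using early r nth_mem[of k r] unfolding assoc.awalk_def by (metis subsetD)
  next
    case False
    then show ?thesis using late cset u(1) unfolding assoc.awalk_def by (metis not_less subsetD)
  qed
  have crit: "(x k, x (Suc k)) \<in> arcs (critical_graph A)" if "length r \<le> k" for k
    unfolding late[OF that] using cset c by auto
  have "x 0 = i"
    using r by (cases r) (auto simp: x_def assoc.awalk_Cons_iff assoc.awalk_Nil_iff)
  \<comment> \<open>The subtraction in \<open>q\<close> is not truncated, because the cyclicity is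
    positive.\<close>
  have le: "length r \<le> ?N" using cyclicity_critical_graph_pos[of A] by simp
  let ?w = "\<lambda>k. arc_cost A (x k, x (Suc k)) - a"
  have "(\<Sum>k<length r + q. ?w k) = (\<Sum>k<length r. ?w k) + (\<Sum>k<q. ?w (length r + k))"
    by (induction q) auto
  moreover have "length r + q = ?N + t" using le q by linarith
  moreover have "(\<Sum>k<length r. ?w k) = (\<Sum>e\<leftarrow>r. arc_cost A e) - real (length r) * a"
    by (simp add: early sum_subtractf sum_list_sum_nth atLeast0LessThan)
  moreover have "(\<Sum>k<q. ?w (length r + k)) = (\<Sum>k<q. arc_cost A (c ! ((s + k) mod length c)) - a)"
    by (simp add: late)
  ultimately have "real t * a + (\<Sum>k<?N + t. ?w k) =
      real t * a + ((\<Sum>e\<leftarrow>r. arc_cost A e) - real (length r) * a)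
      + (\<Sum>k<q. arc_cost A (c ! ((s + k) mod length c)) - a)"
    by simp
  then show ?thesis
    using csr_term_ge[where l = "length r" and x = x and t = t, OF A a arcs crit refl] \<open>x 0 = i\<close>
    by metis
qed

section \<open>Partial sums along a cycle and matrix parameters\<close>

text \<open>Shifting the window by one drops the index \<open>s\<close> and adds
  \<open>s + c\<close>, which agree modulo \<open>c\<close>.\<close>

lemma sum_rotate_mod:
  fixes h :: "nat \<Rightarrow> real"
  shows "(\<Sum>k<c. h ((s + k) mod c)) = (\<Sum>k<c. h k)"
proof (induction s)
  case (Suc s)
  let ?g = "\<lambda>k. h ((s + k) mod c)"
  have "(\<Sum>k<Suc c. ?g k) = ?g 0 + (\<Sum>k<c. ?g (Suc k))"
    by (rule sum.lessThan_Suc_shift)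
  then show ?case using Suc by simp
qed simp

text \<open>Complete rounds sum to zero, so only a remainder of fewer than \<open>c\<close> terms
  counts. The first bound estimates these terms from below; the second estimates from above the
  terms missing to a complete round.\<close>

lemma sum_mod_lower_bounds:
  fixes h :: "nat \<Rightarrow> real"
  assumes "c > 0" and zero: "(\<Sum>k<c. h k) = 0" and h: "\<And>k. k < c \<Longrightarrow> lo \<le> h k \<and> h k \<le> hi"
  shows "real (c - 1) * lo \<le> (\<Sum>k<q. h ((s + k) mod c))"
    and "- (real (c - 1) * hi) \<le> (\<Sum>k<q. h ((s + k) mod c))"
proof -
  have "real c * lo \<le> 0" "0 \<le> real c * hi"
    using sum_bounded_below[of "{..<c}" lo h] sum_bounded_above[of "{..<c}" h hi] h zero by auto
  then have lh: "lo \<le> 0" "0 \<le> hi" using \<open>c > 0\<close> by (auto simp: mult_le_0_iff zero_le_mult_iff)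
  have b: "lo \<le> h (k mod c)" "h (k mod c) \<le> hi" for k using h \<open>c > 0\<close> by auto
  have "real (c - 1) * lo \<le> (\<Sum>k<q. h ((s + k) mod c)) \<and>
    - (real (c - 1) * hi) \<le> (\<Sum>k<q. h ((s + k) mod c))"
  proof (induction q rule: less_induct)
    case (less q)
    show ?case
    proof (cases "q < c")
      case True
      have "real (c - 1) * lo \<le> real q * lo"
        using True lh by (intro mult_right_mono_neg) auto
      also have "\<dots> \<le> (\<Sum>k<q. h ((s + k) mod c))"
        using sum_bounded_below[of "{..<q}" lo "\<lambda>k. h ((s + k) mod c)"] b by simp
      finally have 1: "real (c - 1) * lo \<le> (\<Sum>k<q. h ((s + k) mod c))" .
      have "- (real (c - 1) * hi) \<le> (\<Sum>k<q. h ((s + k) mod c))"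
      \<comment> \<open>For \<open>q = 0\<close> the missing part would have \<open>c\<close> terms
        instead of at most \<open>c - 1\<close>; the empty sum is handled by
        \<open>0 \<le> hi\<close>.\<close>
      proof (cases "q = 0")
        case False
        have "(\<Sum>k<q. h ((s + k) mod c)) + (\<Sum>k\<in>{q..<c}. h ((s + k) mod c)) = 0"
          using sum_rotate_mod[of h s c] zero True
            sum.atLeastLessThan_concat[of 0 q c "\<lambda>k. h ((s + k) mod c)"]
          by (simp add: atLeast0LessThan)
        moreover have "(\<Sum>k\<in>{q..<c}. h ((s + k) mod c)) \<le> real (c - q) * hi"
          using sum_bounded_above[of "{q..<c}" "\<lambda>k. h ((s + k) mod c)" hi] b by simp
        moreover have "real (c - q) * hi \<le> real (c - 1) * hi"
          using False lh by (intro mult_right_mono) auto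
        ultimately show ?thesis by linarith
      qed (use lh in simp)
      with 1 show ?thesis by simp
    next
      case False
      have "(\<Sum>k<c + r. h ((s + k) mod c)) =
          (\<Sum>k<c. h ((s + k) mod c)) + (\<Sum>k<r. h ((s + (c + k)) mod c))" for r
        by (induction r) auto
      moreover have "(s + (c + k)) mod c = (s + k) mod c" for k
        by (metis add.left_commute mod_add_self1)
      ultimately have "(\<Sum>k<c + (q - c). h ((s + k) mod c)) = (\<Sum>k<q - c. h ((s + k) mod c))"
        using sum_rotate_mod[of h s c] zero by simp
      then show ?thesis using False less[of "q - c"] \<open>c > 0\<close> by simp
    qed
  qed
  then show "real (c - 1) * lo \<le> (\<Sum>k<q. h ((s + k) mod c))"
    and "- (real (c - 1) * hi) \<le> (\<Sum>k<q. h ((s + k) mod c))" by auto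
qed

text \<open>The sums over the different starting points average to zero.\<close>

lemma exists_rotation_nonneg:
  fixes h :: "nat \<Rightarrow> real"
  assumes "c > 0" and "(\<Sum>k<c. h k) = 0"
  shows "\<exists>s<c. 0 \<le> (\<Sum>k<q. h ((s + k) mod c))"
proof (rule ccontr)
  assume "\<not> ?thesis"
  then have "(\<Sum>s<c. \<Sum>k<q. h ((s + k) mod c)) < (\<Sum>s<c. 0)"
    using \<open>c > 0\<close> by (intro sum_strict_mono) (auto simp: not_le)
  moreover have "(\<Sum>s<c. \<Sum>k<q. h ((s + k) mod c)) = (\<Sum>k<q. \<Sum>s<c. h ((k + s) mod c))"
    by (subst sum.swap) (simp add: add.commute)
  ultimately show False using assms by (simp add: sum_rotate_mod)
qed

section \<open>Real bounds for edge weights, cycle means and vector entries\<close>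

lemma sum_list_arc_cost_bounds:
  assumes "\<And>e. e \<in> arcs (assoc_digraph A) \<Longrightarrow> lo \<le> arc_cost A e \<and> arc_cost A e \<le> hi"
    and "set p \<subseteq> arcs (assoc_digraph A)"
  shows "lo * real (length p) \<le> (\<Sum>e\<leftarrow>p. arc_cost A e)"
    and "(\<Sum>e\<leftarrow>p. arc_cost A e) \<le> hi * real (length p)"
  using assms(2)
proof (induction p)
  case (Cons e p)
  { case 1 then show ?case using Cons assms(1)[of e] by (simp add: algebra_simps) }
  { case 2 then show ?case using Cons assms(1)[of e] by (simp add: algebra_simps) }
qed simp_all

text \<open>On a critical cycle, \<open>a\<close> is the average of edge weights that lie between
  the bounds.\<close>

lemma max_cycle_mean_bounds:
  assumes "mp_matrix A" and "max_cycle_mean A = ereal a"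
    and b: "\<And>e. e \<in> arcs (assoc_digraph A) \<Longrightarrow> lo \<le> arc_cost A e \<and> arc_cost A e \<le> hi"
  shows "lo \<le> a" and "a \<le> hi"
proof -
  obtain c where c: "c \<in> critical_cycles A" "(\<Sum>e\<leftarrow>c. arc_cost A e) = a * real (length c)"
    using critical_cycles_nonempty[OF assms(1,2)] critical_cycle_cost[OF assms(1,2)] by blast
  then obtain u where "assoc.awalk A u c u" "c \<noteq> []"
    by (auto simp: critical_cycles_def elim: mp_cyclesD)
  then show "lo \<le> a" "a \<le> hi"
    using sum_list_arc_cost_bounds[of A lo hi c] b c(2) by (auto simp: assoc.awalk_def)
qed

text \<open>Both parameters are extrema of the real edge weights. That \<open>lo\<close> is attained
  allows the minima of a matrix and of a subordinate one to be compared.\<close>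

lemma finite_entries_bounds:
  assumes A: "mp_matrix A" and "arcs (assoc_digraph A) \<noteq> {}"
  obtains lo hi where "min_entry A = ereal lo" "mp_norm A = ereal (hi - lo)"
    and "\<And>e. e \<in> arcs (assoc_digraph A) \<Longrightarrow> lo \<le> arc_cost A e \<and> arc_cost A e \<le> hi"
    and "lo \<in> arc_cost A ` arcs (assoc_digraph A)"
proof -
  let ?F = "arc_cost A ` arcs (assoc_digraph A)"
  have "\<bar>A $ i $ j\<bar> \<noteq> \<infinity> \<longleftrightarrow> A $ i $ j \<noteq> -\<infinity>" for i j
    using A by (cases "A $ i $ j") (auto simp: mp_matrix_def)
  then have "finite_entries A = (\<lambda>(i, j). A $ i $ j) ` arcs (assoc_digraph A)"
    by (auto simp: finite_entries_def image_def)
  also have "\<dots> = (\<lambda>e. ereal (arc_cost A e)) ` arcs (assoc_digraph A)"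
    by (intro image_cong refl) (use ereal_arc_cost[OF A] in auto)
  finally have F: "finite_entries A = ereal ` ?F" by (simp add: image_image)
  have fin: "finite ?F" "?F \<noteq> {}" using assms by auto
  have "Min (ereal ` ?F) = ereal (Min ?F)" "Max (ereal ` ?F) = ereal (Max ?F)"
    using mono_Min_commute[OF _ fin, of ereal] mono_Max_commute[OF _ fin, of ereal]
    by (auto simp: mono_def)
  then show thesis
    using that[of "Min ?F" "Max ?F"] fin F by (auto simp: min_entry_def mp_norm_def)
qed

lemma finite_entries_vec_bounds:
  fixes v :: "ereal^'n"
  assumes v: "\<And>i. v $ i = ereal (w i)"
  obtains lo hi where "mp_norm_vec v = ereal (hi - lo)" and "\<And>i. lo \<le> w i \<and> w i \<le> hi"
proof -
  have F: "finite_entries_vec v = ereal ` range w"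
    by (auto simp: finite_entries_vec_def v)
  have "Min (ereal ` range w) = ereal (Min (range w))" "Max (ereal ` range w) = ereal (Max (range w))"
    using mono_Min_commute[of ereal "range w"] mono_Max_commute[of ereal "range w"]
    by (auto simp: mono_def)
  then show thesis
    using that[of "Max (range w)" "Min (range w)"] F by (auto simp: mp_norm_vec_def)
qed

section \<open>Thresholds as infima, and lengths of paths\<close>

text \<open>The ceiling is an infimum over the naturals that are at least \<open>x\<close>, and each
  of these is a threshold. If there are none, the bound is the top element.\<close>

lemma T2_vec_le_ceil:
  assumes "\<And>t i. x \<le> ereal (real t) \<Longrightarrow>
    mp_mult_vec (mp_power B t) v $ i \<le> mp_mult_vec (csr_term A t) v $ i"
  shows "T2_vec A B v \<le> ceil_enat x"
  unfolding ceil_enat_def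
proof (rule INF_greatest)
  fix m :: nat assume m: "m \<in> {m. x \<le> ereal (real m)}"
  have "x \<le> ereal (real t)" if "m \<le> t" for t
    using order_trans[of x "ereal (real m)" "ereal (real t)"] m that by simp
  then show "T2_vec A B v \<le> enat m"
    unfolding T2_vec_def using assms by (intro INF_lower) simp
qed

lemma T2_vec_le_T2: "T2_vec A B v \<le> T2 A B"
  unfolding T2_vec_def T2_def
proof (rule INF_superset_mono)
  show "{T. \<forall>t\<ge>T. \<forall>i j. mp_power B t $ i $ j \<le> csr_term A t $ i $ j} \<subseteq>
    {T. \<forall>t\<ge>T. \<forall>i. mp_mult_vec (mp_power B t) v $ i \<le> mp_mult_vec (csr_term A t) v $ i}"
    by (auto simp: mp_mult_vec_def intro!: SUP_mono' add_right_mono)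
qed simp

lemma max_path_length_ge:
  assumes "assoc.apath B u p w"
  shows "length p \<le> max_path_length (assoc_digraph B)"
proof -
  have "finite {length p | u p w. assoc.apath B u p w}"
    by (rule finite_subset[of _ "{..CARD('a)}"]) (auto dest: assoc.length_apath)
  then show ?thesis unfolding max_path_length_def using assms by (intro Max_ge) auto
qed

lemma max_path_length_attained:
  obtains u p w where "assoc.apath B u p w" "length p = max_path_length (assoc_digraph B)"
proof -
  have "finite {length p | u p w. assoc.apath B u p w}"
    by (rule finite_subset[of _ "{..CARD('a)}"]) (auto dest: assoc.length_apath)
  \<comment> \<open>The empty path at an arbitrary node keeps the maximum from ranging over the
    empty set.\<close>
  moreover have "assoc.apath B undefined [] undefined" by (simp add: assoc.apath_Nil_iff)
  ultimately have "max_path_length (assoc_digraph B) \<in> {length p | u p w. assoc.apath B u p w}"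
    unfolding max_path_length_def by (intro Max_in) blast+
  then show thesis using that by auto
qed

text \<open>If a longest path has an edge, all its nodes are endpoints of edges and hence lie in
  every \<open>I\<close> that covers the entries other than \<open>-\<infinity>\<close>; they are
  distinct. For the empty path, \<open>I \<noteq> {}\<close> is enough.\<close>

lemma max_path_length_less_support_size: "max_path_length (assoc_digraph B) + 1 \<le> support_size B"
proof -
  obtain u p w where p: "assoc.apath B u p w" "length p = max_path_length (assoc_digraph B)"
    by (rule max_path_length_attained)
  have aw: "assoc.awalk B u p w" and dist: "distinct (assoc.awalk_verts B u p)"
    using p by (auto simp: assoc.apath_def)
  have "length p + 1 \<le> card I"
    if I: "I \<noteq> {}" "\<forall>i j. B $ i $ j \<noteq> -\<infinity> \<longrightarrow> i \<in> I \<and> j \<in> I" for I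
  proof (cases p)
    case Nil
    then show ?thesis using I by (simp add: Suc_le_eq card_gt_0_iff)
  next
    case (Cons e p')
    have "set (assoc.awalk_verts B u p) \<subseteq> I"
    proof
      fix x assume "x \<in> set (assoc.awalk_verts B u p)"
      moreover have "p \<noteq> []" using Cons by simp
      ultimately have "x \<in> fst ` set p \<union> snd ` set p"
        using assoc.set_awalk_verts_not_Nil[OF aw] by simp
      then obtain e where e: "e \<in> set p" "x = fst e \<or> x = snd e" by blast
      then have "e \<in> arcs (assoc_digraph B)" using aw unfolding assoc.awalk_def by blast
      then show "x \<in> I" using e(2) I(2) by (cases e) auto
    qed
    then have "card (set (assoc.awalk_verts B u p)) \<le> card I" by (intro card_mono) auto
    then show ?thesis using dist by (simp add: distinct_card assoc.length_awalk_verts)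
  qed
  moreover have "UNIV \<in> {I. I \<noteq> {} \<and> (\<forall>i j. B $ i $ j \<noteq> -\<infinity> \<longrightarrow> i \<in> I \<and> j \<in> I)}" by simp
  ultimately have "length p + 1 \<le> support_size B"
    unfolding support_size_def by (intro Min.boundedI) (simp, blast, force)
  then show ?thesis using p by simp
qed

section \<open>Powers of subordinate matrices\<close>

lemma awalk_verts_cong:
  "tail G = tail H \<Longrightarrow> head G = head H \<Longrightarrow> pre_digraph.awalk_verts G u p = pre_digraph.awalk_verts H u p"
  by (induction p arbitrary: u) (auto simp: pre_digraph.awalk_verts.simps)

lemma subordinate_mp_matrix: "mp_matrix A \<Longrightarrow> subordinate B A \<Longrightarrow> mp_matrix B"
  unfolding mp_matrix_def subordinate_def by (metis MInfty_neq_PInfty(1))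

lemma subordinate_arcs_subset:
  "subordinate B A \<Longrightarrow> arcs (assoc_digraph B) \<subseteq> arcs (assoc_digraph A)"
  unfolding subordinate_def by force

lemma subordinate_arc_cost:
  assumes "subordinate B A" and "e \<in> arcs (assoc_digraph B)"
  shows "arc_cost B e = arc_cost A e"
proof -
  obtain i j where e: "e = (i, j)" by fastforce
  then have "B $ i $ j = A $ i $ j" using assms unfolding subordinate_def by force
  then show ?thesis using e by (simp add: arc_cost_def)
qed

lemma subordinate_apath:
  assumes "subordinate B A" and "assoc.apath B u p v"
  shows "assoc.apath A u p v"
  using assms(2) subordinate_arcs_subset[OF assms(1)]
    cas_cong[of "assoc_digraph A" "assoc_digraph B" u p v]
    awalk_verts_cong[of "assoc_digraph A" "assoc_digraph B" u p]
  unfolding assoc.apath_def assoc.awalk_def by (metis assoc_digraph_sel(1,3,4) subset_trans)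

text \<open>Without cycles no walk revisits a node, so each walk is a path and cannot have
  \<open>t\<close> edges.\<close>

lemma mp_power_acyclic_eq:
  assumes B: "mp_matrix B" and "max_cycle_mean B = -\<infinity>"
    and t: "max_path_length (assoc_digraph B) + 1 \<le> t"
  shows "mp_power B t $ i $ j = -\<infinity>"
proof (rule ccontr)
  assume "mp_power B t $ i $ j \<noteq> -\<infinity>"
  then obtain p where p: "assoc.awalk B i p j" "length p = t"
    using mp_power_attained[OF B] by blast
  \<comment> \<open>Cycle means are real, so the value \<open>-\<infinity>\<close> arises only if
    there is no cycle.\<close>
  have "mp_cycles B = {}"
  proof (rule ccontr)
    assume ne: "mp_cycles B \<noteq> {}"
    then have "max_cycle_mean B \<in> walk_mean B ` mp_cycles B"
      using finite_mp_cycles[of B] by (simp add: max_cycle_mean_def)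
    then show False using walk_mean_eq[OF B] assms(2) by auto
  qed
  then have nc: "\<not> assoc.closed_w B r" for r
    using assoc.closed_w_imp_cycle[of B r] by (auto simp: mp_cycles_def)
  have "distinct (assoc.awalk_verts B i p)"
    using assoc.awalk_cyc_decompE'[OF p(1)] nc by metis
  then have "assoc.apath B i p j" using p(1) by (simp add: assoc.apath_def)
  then show False using max_path_length_ge[of B i p j] p(2) t by simp
qed

text \<open>Each walk of \<open>B\<close> is dominated separately, by an entry of \<open>X\<close>
  in a column \<open>k\<close> that may differ from the endpoint of the walk. Entries equal to
  \<open>-\<infinity>\<close> remain so when a finite entry of \<open>v\<close> is added.\<close>

lemma mp_mult_vec_mp_power_le:
  assumes B: "mp_matrix B" and v: "\<And>i. v $ i = ereal (w i)"
    and walk: "\<And>p j. assoc.awalk B i p j \<Longrightarrow> length p = t \<Longrightarrow>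
      \<exists>k y. ereal y \<le> X $ i $ k \<and> (\<Sum>e\<leftarrow>p. arc_cost B e) + w j \<le> y + w k"
  shows "mp_mult_vec (mp_power B t) v $ i \<le> mp_mult_vec X v $ i"
proof -
  have "mp_power B t $ i $ j + v $ j \<le> mp_mult_vec X v $ i" for j
  proof (cases "mp_power B t $ i $ j = -\<infinity>")
    case False
    then obtain p where p: "assoc.awalk B i p j" "length p = t"
      "mp_power B t $ i $ j = ereal (\<Sum>e\<leftarrow>p. arc_cost B e)"
      using mp_power_attained[OF B] by blast
    obtain k y where ky: "ereal y \<le> X $ i $ k" "(\<Sum>e\<leftarrow>p. arc_cost B e) + w j \<le> y + w k"
      using walk[OF p(1,2)] by blast
    have "mp_power B t $ i $ j + v $ j \<le> ereal y + v $ k" using ky(2) p(3) v by simp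
    also have "\<dots> \<le> X $ i $ k + v $ k" by (intro add_right_mono ky)
    also have "\<dots> \<le> mp_mult_vec X v $ i" by (rule mp_mult_vec_ge)
    finally show ?thesis .
  qed (simp add: v)
  then show ?thesis unfolding mp_mult_vec_def[of "mp_power B t"] by (auto intro: SUP_least)
qed

text \<open>
  A walk of \<open>B\<close> is compared with its underlying path \<open>p1 @ p2\<close>, and this with the walk of \<open>A\<close> that
  leaves the path after \<open>p1\<close>, reaches a critical cycle along \<open>z\<close> and stays on it. The rotation of the
  cycle contributes \<open>Q\<close>; which of its two lower bounds is needed depends on whether the path meets
  the cycle.
\<close>

lemma divert_estimate:
  fixes a b lo hi Q t :: real and l1 l2 z c n :: nat
  assumes ord: "lo \<le> b" "b < a" "a \<le> hi" and "c > 0"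
    and len: "l1 + l2 + 1 \<le> n" "z = 0 \<and> l2 + c \<le> n \<or> l1 + l2 + z + c \<le> n"
    and w2: "w2 \<le> hi * real l2" and wz: "lo * real z \<le> wz"
    and Q: "real (c - 1) * (lo - a) \<le> Q" "- (real (c - 1) * (hi - a)) \<le> Q"
    and t: "V + real (n - 1) * (hi - lo) \<le> t * (a - b)"
  shows "w1 + w2 + b * (t - (real l1 + real l2)) + V \<le>
    t * a + (w1 + wz - (real l1 + real z) * a) + Q"
proof -
  \<comment> \<open>The distances of \<open>a\<close> from the two extreme weights add up to
    \<open>hi - lo\<close>. Below, the multiplicities of \<open>x\<close> and of \<open>y\<close>
    are bounded by \<open>n - 1\<close> separately.\<close>
  define x y where "x = a - lo" and "y = hi - a"
  have xy: "x \<ge> 0" "y \<ge> 0" "hi - lo = x + y" using ord by (auto simp: x_def y_def)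
  have c1: "real (c - 1) = real c - 1" using \<open>c > 0\<close> by simp
  have n1: "real (n - 1) = real n - 1" using len(1) by simp
  \<comment> \<open>Cancelling \<open>w1\<close> and inserting the bounds on \<open>w2\<close> and
    \<open>wz\<close> reduces the claim to \<open>l2 * (hi - b) + l1 * (a - b) + z * x - Q + V \<le>
    t * (a - b)\<close>.\<close>
  have "real l2 * (hi - b) \<le> real l2 * (x + y)"
    using ord by (intro mult_left_mono) (auto simp: x_def y_def)
  moreover have "real l1 * (a - b) \<le> real l1 * x"
    using ord by (intro mult_left_mono) (auto simp: x_def)
  ultimately have main: "real l2 * (hi - b) + real l1 * (a - b) + real z * x - Q \<le>
      (real l2 + real l1) * x + real l2 * y + real z * x - Q"
    by (simp add: algebra_simps)
  have "(real l2 + real l1) * x + real l2 * y + real z * x - Q \<le> real (n - 1) * (x + y)"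
    using len(2)
  proof
    \<comment> \<open>Here \<open>Q\<close> is charged to \<open>y\<close>, which then occurs at
      most \<open>l2 + (c - 1)\<close> times, while \<open>x\<close> occurs \<open>l1 + l2\<close>
      times.\<close>
    assume "z = 0 \<and> l2 + c \<le> n"
    then have z: "z = 0" and lc: "real l2 + (real c - 1) \<le> real n - 1" by auto
    have "(real l2 + real l1) * x \<le> (real n - 1) * x"
      using len(1) xy by (intro mult_right_mono) auto
    moreover have "(real l2 + (real c - 1)) * y \<le> (real n - 1) * y"
      using lc xy by (intro mult_right_mono) auto
    moreover have "- Q \<le> (real c - 1) * y" using Q(2) unfolding c1 y_def by linarith
    ultimately show ?thesis using z unfolding n1 by (simp add: algebra_simps)
  next
    \<comment> \<open>Here \<open>Q\<close> is charged to \<open>x\<close>, which then occurs at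
      most \<open>l1 + l2 + z + (c - 1)\<close> times, while \<open>y\<close> occurs
      \<open>l2\<close> times.\<close>
    assume "l1 + l2 + z + c \<le> n"
    then have "(real l1 + real l2 + real z + (real c - 1)) * x \<le> (real n - 1) * x"
      and "real l2 * y \<le> (real n - 1) * y"
      using len(1) xy \<open>c > 0\<close> by (auto intro!: mult_right_mono)
    moreover have "- Q \<le> (real c - 1) * x"
      using Q(1) unfolding c1 x_def by (simp add: algebra_simps)
    ultimately show ?thesis unfolding n1 by (simp add: algebra_simps)
  qed
  then have "real l2 * (hi - b) + real l1 * (a - b) + real z * x - Q + V \<le> t * (a - b)"
    using main t xy(3) by simp
  then show ?thesis using w2 wz unfolding x_def by (simp add: algebra_simps)
qed

lemma critical_cycle_normalized_sum:
  assumes "mp_matrix A" and "max_cycle_mean A = ereal a" and "c \<in> critical_cycles A"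
  shows "(\<Sum>k<length c. arc_cost A (c ! k) - a) = 0"
  using critical_cycle_cost[OF assms]
  by (simp add: sum_subtractf sum_list_sum_nth atLeast0LessThan)

section \<open>Vector inequalities for a matrix \<open>B\<close> with a cycle\<close>

text \<open>The path underlying a walk of \<open>B\<close> is also a path of \<open>A\<close>, so it
  can be diverted within the strongly connected digraph of \<open>A\<close>. The term
  \<open>vhi - vlo\<close> pays for the change of the endpoint.\<close>

lemma mp_power_le_csr_term_vec:
  fixes A B :: "ereal^'n^'n"
  assumes A: "mp_matrix A" and irr: "mp_irreducible A" and sub: "subordinate B A"
    and a: "max_cycle_mean A = ereal a" and b: "max_cycle_mean B = ereal b" and "b < a"
    and ent: "\<And>e. e \<in> arcs (assoc_digraph A) \<Longrightarrow> lo \<le> arc_cost A e \<and> arc_cost A e \<le> hi"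
    and v: "\<And>i. v $ i = ereal (w i)" and vb: "\<And>i. vlo \<le> w i \<and> w i \<le> vhi"
    and t: "vhi - vlo + real (CARD('n) - 1) * (hi - lo) \<le> real t * (a - b)"
  shows "mp_mult_vec (mp_power B t) v $ i \<le> mp_mult_vec (csr_term A t) v $ i"
proof (rule mp_mult_vec_mp_power_le[OF subordinate_mp_matrix[OF A sub] v])
  fix p j assume p: "assoc.awalk B i p j" "length p = t"
  have B: "mp_matrix B" by (rule subordinate_mp_matrix[OF A sub])
  from assoc.walk_cost_le_apath[OF cycle_cost_le[OF B b] p(1)] obtain q where q: "assoc.apath B i q j" "length q \<le> t"
    "(\<Sum>e\<leftarrow>p. arc_cost B e) \<le> (\<Sum>e\<leftarrow>q. arc_cost B e) + b * (real t - real (length q))"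
    using p(2) by blast
  have qA: "assoc.apath A i q j" by (rule subordinate_apath[OF sub q(1)])
  have qset: "set q \<subseteq> arcs (assoc_digraph B)" using q(1) by (auto simp: assoc.apath_def assoc.awalk_def)
  have "(\<Sum>e\<leftarrow>q. arc_cost B e) = (\<Sum>e\<leftarrow>q. arc_cost A e)"
    using subordinate_arc_cost[OF sub] qset by (intro arg_cong[of _ _ sum_list] map_cong) auto
  obtain c where c: "c \<in> critical_cycles A"
    using critical_cycles_nonempty[OF A a] by blast
  then have cyc: "c \<in> mp_cycles A" by (simp add: critical_cycles_def)
  obtain u where u: "assoc.awalk A u c u" "c \<noteq> []" using mp_cyclesD[OF cyc] .
  have reach: "x \<rightarrow>\<^sup>*\<^bsub>assoc_digraph A\<^esub> y" for x y
    using irr by (simp add: mp_irreducible_def strongly_connected_def)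
  obtain p1 p2 x z k where d: "q = p1 @ p2" "assoc.awalk A i p1 x" "assoc.awalk A x z k"
    "k \<in> fst ` set c"
    "z = [] \<and> length p2 + card (fst ` set c) \<le> card (verts (assoc_digraph A)) \<or>
      length q + length z + card (fst ` set c) \<le> card (verts (assoc_digraph A))"
    using assoc.apath_divert[OF reach qA, of "fst ` set c"] u(2)
    by (metis assoc_digraph_sel(1) image_is_empty set_empty subset_UNIV)
  obtain s where s: "s < length c" "k = fst (c ! s)" using d(4) by (auto simp: in_set_conv_nth)
  have r: "assoc.awalk A i (p1 @ z) (fst (c ! (s mod length c)))" using d(2,3) s by auto
  define h where "h k = arc_cost A (c ! k) - a" for k
  define m where "m = length (p1 @ z) * cyclicity (critical_graph A) + t - length (p1 @ z)"
  define Q where "Q = (\<Sum>k<m. h ((s + k) mod length c))"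
  obtain l where l: "ereal (real t * a + ((\<Sum>e\<leftarrow>p1 @ z. arc_cost A e) - real (length (p1 @ z)) * a) + Q)
      \<le> csr_term A t $ i $ l"
    using csr_term_ge_walk[OF A a c r m_def] unfolding Q_def h_def by blast
  have h: "lo - a \<le> h k \<and> h k \<le> hi - a" if "k < length c" for k
    using ent[of "c ! k"] u(1) nth_mem[OF that] unfolding h_def assoc.awalk_def by auto
  have "length c > 0" "(\<Sum>k<length c. h k) = 0"
    using critical_cycle_normalized_sum[OF A a c] u(2) by (simp_all add: h_def)
  from sum_mod_lower_bounds[OF this h]
  have Q: "real (length c - 1) * (lo - a) \<le> Q" "- (real (length c - 1) * (hi - a)) \<le> Q"
    unfolding Q_def by blast+
  have "assoc.awalk A i q j" using qA by (simp add: assoc.apath_def)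
  then have sets: "set p2 \<subseteq> arcs (assoc_digraph A)" "set z \<subseteq> arcs (assoc_digraph A)"
    using d(1,3) by (auto simp: assoc.awalk_def)
  \<comment> \<open>Edges of \<open>B\<close> have the same weights in \<open>A\<close>, so
    \<open>lo\<close> bounds the cycle mean of \<open>B\<close> as well.\<close>
  have "lo \<le> b" using max_cycle_mean_bounds(1)[OF B b, of lo hi] ent subordinate_arcs_subset[OF sub]
      subordinate_arc_cost[OF sub] by fastforce
  moreover have "a \<le> hi" using max_cycle_mean_bounds(2)[OF A a ent] .
  moreover have "length p1 + length p2 + 1 \<le> CARD('n)"
    using assoc.length_apath_less[OF qA] d(1) by simp
  moreover have "length z = 0 \<and> length p2 + length c \<le> CARD('n) \<or>
      length p1 + length p2 + length z + length c \<le> CARD('n)"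
    using d(1,5) card_cycle_verts[OF cyc] by auto
  moreover have "(\<Sum>e\<leftarrow>p2. arc_cost A e) \<le> hi * real (length p2)"
    by (rule sum_list_arc_cost_bounds(2)[OF ent sets(1)])
  moreover have "lo * real (length z) \<le> (\<Sum>e\<leftarrow>z. arc_cost A e)"
    by (rule sum_list_arc_cost_bounds(1)[OF ent sets(2)])
  ultimately have "(\<Sum>e\<leftarrow>p1. arc_cost A e) + (\<Sum>e\<leftarrow>p2. arc_cost A e) +
      b * (real t - (real (length p1) + real (length p2))) + (vhi - vlo) \<le>
      real t * a + ((\<Sum>e\<leftarrow>p1. arc_cost A e) + (\<Sum>e\<leftarrow>z. arc_cost A e) -
        (real (length p1) + real (length z)) * a) + Q"
    using u(2) \<open>b < a\<close> Q t by (intro divert_estimate[where n = "CARD('n)" and c = "length c"]) auto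
  then have "(\<Sum>e\<leftarrow>p. arc_cost B e) + w j \<le>
      real t * a + ((\<Sum>e\<leftarrow>p1 @ z. arc_cost A e) - real (length (p1 @ z)) * a) + Q + w l"
    using q(3) d(1) vb[of j] vb[of l] \<open>(\<Sum>e\<leftarrow>q. arc_cost B e) = (\<Sum>e\<leftarrow>q. arc_cost A e)\<close> by simp
  then show "\<exists>k y. ereal y \<le> csr_term A t $ i $ k \<and> (\<Sum>e\<leftarrow>p. arc_cost B e) + w j \<le> y + w k"
    using l by blast
qed

text \<open>Two single edges replace the paths. Both ends of a nonempty walk of \<open>B\<close> lie
  in the index set \<open>N\<close> of \<open>B\<close>, so \<open>(j, i)\<close> is an edge of
  \<open>B\<close> and closes the walk, at the price \<open>b - lob\<close>. In \<open>A\<close>,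
  one edge leads from \<open>i\<close> to any node of a critical cycle, at a price of at most
  \<open>a - lo\<close>.\<close>

lemma mp_power_le_csr_term_vec_full:
  fixes A B :: "ereal^'n^'n"
  assumes A: "mp_matrix A" and full: "\<And>i j. A $ i $ j \<noteq> -\<infinity>"
    and sub: "subordinate B A" and node: "node_subordinate B A"
    and a: "max_cycle_mean A = ereal a" and b: "max_cycle_mean B = ereal b"
    and lo: "\<And>e. lo \<le> arc_cost A e"
    and lob: "\<And>e. e \<in> arcs (assoc_digraph B) \<Longrightarrow> lob \<le> arc_cost B e" and "lob \<le> b"
    and v: "\<And>i. v $ i = ereal (w i)" and vb: "\<And>i. vlo \<le> w i \<and> w i \<le> vhi"
    and t: "vhi - vlo + (a - lo) + (b - lob) \<le> real t * (a - b)"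
  shows "mp_mult_vec (mp_power B t) v $ i \<le> mp_mult_vec (csr_term A t) v $ i"
proof (rule mp_mult_vec_mp_power_le[OF subordinate_mp_matrix[OF A sub] v])
  fix p j assume p: "assoc.awalk B i p j" "length p = t"
  have B: "mp_matrix B" by (rule subordinate_mp_matrix[OF A sub])
  have W: "(\<Sum>e\<leftarrow>p. arc_cost B e) \<le> b * real t + (b - lob)"
  proof (cases p)
    \<comment> \<open>The empty walk need not be closed: its weight \<open>0\<close> is covered by
      \<open>lob \<le> b\<close>.\<close>
    case Nil
    then show ?thesis using p(2) \<open>lob \<le> b\<close> by simp
  next
    case (Cons e p')
    obtain N where N: "\<And>i j. B $ i $ j = (if i \<in> N \<and> j \<in> N then A $ i $ j else -\<infinity>)"
      using node unfolding node_subordinate_def by blast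
    have ne: "p \<noteq> []" using Cons by simp
    have nodes: "e \<in> set p \<Longrightarrow> fst e \<in> N \<and> snd e \<in> N" for e
      using p(1) N by (cases e) (auto simp: assoc.awalk_def split: if_splits)
    have "i \<in> N" using p(1) nodes[of e] Cons by (auto simp: assoc.awalk_Cons_iff)
    moreover have "j = snd (last p)"
      using awalk_snd_nth[OF p(1), of "length p - 1"] ne by (simp add: last_conv_nth)
    then have "j \<in> N" using nodes[of "last p"] ne by simp
    ultimately have "(j, i) \<in> arcs (assoc_digraph B)" using N full by simp
    then have "assoc.awalk B i (p @ [(j, i)]) i" and l: "lob \<le> arc_cost B (j, i)"
      using p(1) assoc.arc_implies_awalk[of "(j, i)" B] lob by auto
    from assoc.closed_walk_cost_le[OF cycle_cost_le[OF B b] this(1)] l show ?thesis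
      using p(2) by (simp add: algebra_simps)
  qed
  obtain c where c: "c \<in> critical_cycles A"
    using critical_cycles_nonempty[OF A a] by blast
  then have "c \<in> mp_cycles A" by (simp add: critical_cycles_def)
  then have "c \<noteq> []" using mp_cyclesD by blast
  define h where "h k = arc_cost A (c ! k) - a" for k
  define m where "m = 1 * cyclicity (critical_graph A) + t - 1"
  \<comment> \<open>The starting index depends on \<open>m\<close>, hence on \<open>t\<close>. It
    makes the \<open>m\<close> cycle edges that follow the connecting edge contribute a nonnegative
    amount.\<close>
  obtain s where s: "s < length c" "0 \<le> (\<Sum>k<m. h ((s + k) mod length c))"
    using exists_rotation_nonneg[of "length c" h m] critical_cycle_normalized_sum[OF A a c] \<open>c \<noteq> []\<close>
    by (auto simp: h_def)
  let ?r = "[(i, fst (c ! s))]"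
  have r: "assoc.awalk A i ?r (fst (c ! (s mod length c)))"
    using s(1) full by (auto simp: assoc.awalk_Cons_iff assoc.awalk_Nil_iff)
  have m: "m = length ?r * cyclicity (critical_graph A) + t - length ?r" by (simp add: m_def)
  obtain l where l: "ereal (real t * a + ((\<Sum>e\<leftarrow>?r. arc_cost A e) - real (length ?r) * a)
      + (\<Sum>k<m. h ((s + k) mod length c))) \<le> csr_term A t $ i $ l"
    using csr_term_ge_walk[OF A a c r m] unfolding h_def by blast
  have "(\<Sum>e\<leftarrow>p. arc_cost B e) + w j \<le> real t * a + ((\<Sum>e\<leftarrow>?r. arc_cost A e) - real (length ?r) * a)
      + (\<Sum>k<m. h ((s + k) mod length c)) + w l"
    using W s(2) lo[of "(i, fst (c ! s))"] t vb[of j] vb[of l] by (simp add: algebra_simps)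
  then show "\<exists>k y. ereal y \<le> csr_term A t $ i $ k \<and> (\<Sum>e\<leftarrow>p. arc_cost B e) + w j \<le> y + w k"
    using l by blast
qed

section \<open>Bounds for the thresholds\<close>

theorem theorem4p6:
  fixes A B :: "ereal^'n^'n" and v :: "ereal^'n"
  assumes "mp_matrix A"
    and "mp_irreducible A"
    and "subordinate B A"
    and "\<forall>i. \<bar>v $ i\<bar> \<noteq> \<infinity>"
  shows
    "(max_cycle_mean B = -\<infinity> \<longrightarrow>
        T2_vec A B v \<le> T2 A B
        \<and> T2 A B \<le> enat (max_path_length (assoc_digraph B) + 1)
        \<and> max_path_length (assoc_digraph B) + 1 \<le> support_size B)
    \<and>
     (max_cycle_mean B \<noteq> -\<infinity> \<and> max_cycle_mean B < max_cycle_mean A \<longrightarrow>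
        T2_vec A B v
          \<le> ceil_enat ((mp_norm_vec v + ereal (real (CARD('n) - 1)) * mp_norm A)
                        / (max_cycle_mean A - max_cycle_mean B))
        \<and>
        ((\<forall>i j. A $ i $ j \<noteq> -\<infinity>) \<longrightarrow>
          (node_subordinate B A \<longrightarrow>
            T2_vec A B v
              \<le> ceil_enat ((mp_norm_vec v + (max_cycle_mean A - min_entry A)
                              + (max_cycle_mean B - min_entry B))
                            / (max_cycle_mean A - max_cycle_mean B)))
          \<and>
          (mp_norm_vec v + (max_cycle_mean A - min_entry A)
            + (max_cycle_mean B - min_entry B))
            / (max_cycle_mean A - max_cycle_mean B)
          \<le> (2 * mp_norm A + mp_norm_vec v) / (max_cycle_mean A - max_cycle_mean B)))"
proof (rule conjI; rule impI)
  have B: "mp_matrix B" by (rule subordinate_mp_matrix[OF assms(1,3)])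
  assume "max_cycle_mean B = -\<infinity>"
  then have "T2 A B \<le> enat (max_path_length (assoc_digraph B) + 1)"
    unfolding T2_def using mp_power_acyclic_eq[OF B] by (intro INF_lower) simp
  then show "T2_vec A B v \<le> T2 A B
        \<and> T2 A B \<le> enat (max_path_length (assoc_digraph B) + 1)
        \<and> max_path_length (assoc_digraph B) + 1 \<le> support_size B"
    using T2_vec_le_T2 max_path_length_less_support_size by blast
next
  have B: "mp_matrix B" by (rule subordinate_mp_matrix[OF assms(1,3)])
  assume fin: "max_cycle_mean B \<noteq> -\<infinity> \<and> max_cycle_mean B < max_cycle_mean A"
  then obtain b where b: "max_cycle_mean B = ereal b" "critical_cycles B \<noteq> {}"
    using max_cycle_mean_finite[OF B] by metis
  from fin have "max_cycle_mean A \<noteq> -\<infinity>" by auto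
  then obtain a where a: "max_cycle_mean A = ereal a"
    using max_cycle_mean_finite[OF assms(1)] by metis
  have "b < a" using fin a b by simp
  define w where "w i = real_of_ereal (v $ i)" for i
  have v: "v $ i = ereal (w i)" for i using assms(4) by (simp add: w_def ereal_real)
  obtain vlo vhi where vn: "mp_norm_vec v = ereal (vhi - vlo)" "\<And>i. vlo \<le> w i \<and> w i \<le> vhi"
    using finite_entries_vec_bounds[of v w, OF v] by metis
  obtain c where "c \<in> mp_cycles B" using b(2) by (auto simp: critical_cycles_def)
  then obtain u where "assoc.awalk B u c u" "c \<noteq> []" by (rule mp_cyclesD)
  \<comment> \<open>A cycle of \<open>B\<close> provides an edge of \<open>B\<close>, and hence of
    \<open>A\<close>, so the extreme entries are taken over nonempty sets.\<close>
  then have neB: "arcs (assoc_digraph B) \<noteq> {}" unfolding assoc.awalk_def by (metis set_empty subset_empty)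
  then have neA: "arcs (assoc_digraph A) \<noteq> {}"
    using subordinate_arcs_subset[OF assms(3)] by blast
  obtain lo hi where e: "min_entry A = ereal lo" "mp_norm A = ereal (hi - lo)"
    "\<And>e. e \<in> arcs (assoc_digraph A) \<Longrightarrow> lo \<le> arc_cost A e \<and> arc_cost A e \<le> hi"
    using finite_entries_bounds[OF assms(1) neA] by metis
  obtain lob hib where eB: "min_entry B = ereal lob"
    "\<And>e. e \<in> arcs (assoc_digraph B) \<Longrightarrow> lob \<le> arc_cost B e \<and> arc_cost B e \<le> hib"
    "lob \<in> arc_cost B ` arcs (assoc_digraph B)"
    using finite_entries_bounds[OF B neB] by metis
  have "lob \<le> b" using max_cycle_mean_bounds(1)[OF B b(1) eB(2)] .
  have "a \<le> hi" using max_cycle_mean_bounds(2)[OF assms(1) a e(3)] .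
  obtain f where f: "f \<in> arcs (assoc_digraph B)" "lob = arc_cost B f" using eB(3) by (rule imageE)
  then have "f \<in> arcs (assoc_digraph A)" using subordinate_arcs_subset[OF assms(3)] by blast
  \<comment> \<open>The smallest finite entry of \<open>B\<close> is also an entry of
    \<open>A\<close>.\<close>
  from e(3)[OF this] have "lo \<le> lob" using subordinate_arc_cost[OF assms(3) f(1)] f(2) by simp
  show "T2_vec A B v
          \<le> ceil_enat ((mp_norm_vec v + ereal (real (CARD('n) - 1)) * mp_norm A)
                        / (max_cycle_mean A - max_cycle_mean B))
        \<and>
        ((\<forall>i j. A $ i $ j \<noteq> -\<infinity>) \<longrightarrow>
          (node_subordinate B A \<longrightarrow>
            T2_vec A B v
              \<le> ceil_enat ((mp_norm_vec v + (max_cycle_mean A - min_entry A)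
                              + (max_cycle_mean B - min_entry B))
                            / (max_cycle_mean A - max_cycle_mean B)))
          \<and>
          (mp_norm_vec v + (max_cycle_mean A - min_entry A)
            + (max_cycle_mean B - min_entry B))
            / (max_cycle_mean A - max_cycle_mean B)
          \<le> (2 * mp_norm A + mp_norm_vec v) / (max_cycle_mean A - max_cycle_mean B))"
  proof (intro conjI impI)
    show "T2_vec A B v
          \<le> ceil_enat ((mp_norm_vec v + ereal (real (CARD('n) - 1)) * mp_norm A)
                        / (max_cycle_mean A - max_cycle_mean B))"
    proof (rule T2_vec_le_ceil)
      fix t i assume "(mp_norm_vec v + ereal (real (CARD('n) - 1)) * mp_norm A)
                        / (max_cycle_mean A - max_cycle_mean B) \<le> ereal (real t)"
      then have "vhi - vlo + real (CARD('n) - 1) * (hi - lo) \<le> real t * (a - b)"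
        using \<open>b < a\<close> by (simp add: vn e a b pos_divide_le_eq)
      from mp_power_le_csr_term_vec[OF assms(1-3) a b(1) \<open>b < a\<close> e(3) v vn(2) this]
      show "mp_mult_vec (mp_power B t) v $ i \<le> mp_mult_vec (csr_term A t) v $ i" .
    qed
  next
    assume full: "\<forall>i j. A $ i $ j \<noteq> -\<infinity>" and node: "node_subordinate B A"
    show "T2_vec A B v
              \<le> ceil_enat ((mp_norm_vec v + (max_cycle_mean A - min_entry A)
                              + (max_cycle_mean B - min_entry B))
                            / (max_cycle_mean A - max_cycle_mean B))"
    proof (rule T2_vec_le_ceil)
      fix t i assume "(mp_norm_vec v + (max_cycle_mean A - min_entry A)
          + (max_cycle_mean B - min_entry B)) / (max_cycle_mean A - max_cycle_mean B) \<le> ereal (real t)"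
      then have t: "vhi - vlo + (a - lo) + (b - lob) \<le> real t * (a - b)"
        using \<open>b < a\<close> by (simp add: vn e eB a b pos_divide_le_eq)
      have "lo \<le> arc_cost A e" for e using e(3)[of e] full by (cases e) simp
      then show "mp_mult_vec (mp_power B t) v $ i \<le> mp_mult_vec (csr_term A t) v $ i"
        using mp_power_le_csr_term_vec_full[OF assms(1) _ assms(3) node a b(1) _ _ \<open>lob \<le> b\<close> v vn(2) t]
          full eB(2) by blast
    qed
  next
    \<comment> \<open>Since \<open>b < a \<le> hi\<close> and \<open>lo \<le> lob\<close>, each of
      the differences \<open>a - lo\<close> and \<open>b - lob\<close> is at most
      \<open>hi - lo\<close>.\<close>
    have "vhi - vlo + (a - lo) + (b - lob) \<le> 2 * (hi - lo) + (vhi - vlo)"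
      using \<open>lo \<le> lob\<close> \<open>a \<le> hi\<close> \<open>b < a\<close> by simp
    then have "(vhi - vlo + (a - lo) + (b - lob)) / (a - b) \<le> (2 * (hi - lo) + (vhi - vlo)) / (a - b)"
      using \<open>b < a\<close> by (intro divide_right_mono) auto
    moreover have "2 * ereal (hi - lo) = ereal (2 * (hi - lo))"
      by (metis numeral_eq_ereal times_ereal.simps(1))
    ultimately show "(mp_norm_vec v + (max_cycle_mean A - min_entry A)
            + (max_cycle_mean B - min_entry B)) / (max_cycle_mean A - max_cycle_mean B)
          \<le> (2 * mp_norm A + mp_norm_vec v) / (max_cycle_mean A - max_cycle_mean B)"
      using \<open>b < a\<close> by (simp add: vn e eB a b)
  qed
qed

end
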